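(* As $n\to\infty$, $\theta^n_n\to\theta_*$ almost surely. Furthermore, for each $p\in(0,1)$ there is a $\beta>0$ such that for $\mathbf{P}$-a.e. $\omega$ there is an $n_0=n_0(\omega)\in\mathbb{N}$ such that for all $n\ge n_0$ and all integers $k$ with $n^{p}\le k\le n$, $$\|\theta^n_k-\theta_*\|\le k^{-\beta}.$$
   Context: Setting. $\Delta=\Delta^o\cup\{0\}$ is a finite set, $\Delta^o=\{1,\dots,d\}$ nonempty, $0\notin\Delta^o$. $P=(P_{x,y})_{x,y\in\Delta}$ is the transition matrix of a Markov chain $\{Y_n\}$ on $\Delta$ with $0$ absorbing ($P_{0,0}=1$); $\Delta^o$ is an irreducible class of the chain and $P_{x,0}>0$ for some $x\in\Delta^o$. $\mathcal{P}(\Delta^o)$ (probability measures on $\Delta^o$) is identified with the simplex $\{x\in\mathbb{R}_+^d:\sum_i x_i=1\}$; $\|\cdot\|$ is a norm on $\mathbb{R}^d$. $\theta_*$ is the unique quasi-stationary distribution (QSD): the unique $\mu\in\mathcal{P}(\Delta^o)$ with $\mathbf{P}_\mu(Y_n=x\mid Y_n\in\Delta^o)=\mu(x)$ for all $x\in\Delta^o$, $n\in\mathbb{N}$ (chain started from $\mu$). For $\nu\in\mathcal{P}(\Delta^o)$, $K[\nu]_{x,y}=P_{x,y}+P_{x,0}\,\nu(y)$, $x,y\in\Delta^o$. Step sizes: $\gamma_*>0$, $N_*=\lfloor\gamma_*\rfloor+1$, $\gamma_{k+1}=\gamma_*/(k+N_* )$ for $k\in\mathbb{N}_0$. Algorithm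 I. $\{a(n)\}_{n\in\mathbb N}$ is a sequence of positive integers increasing to $\infty$; $x_0\in\Delta^o$ is fixed. On a probability space $(\Omega,\mathcal F,\mathbf P)$, for every $n\in\mathbb N$ there are $\Delta^o$-valued random variables $X^{i,n}_k$ ($1\le i\le a(n)$, $k\in\mathbb N_0$), random probability measures $\theta^n_k$ and $\sigma$-fields $\mathcal F^n_k$ such that: $X^{i,n}_0=x_0$, $\theta^n_0=\delta_{x_0}$, $\mathcal F^n_0=\{\emptyset,\Omega\}$; on $\{X^{1,n}_k=x_1,\dots,X^{a(n),n}_k=x_{a(n)}\}$, $$\mathbf P(X^{1,n}_{k+1}=y_1,\dots,X^{a(n),n}_{k+1}=y_{a(n)}\mid\mathcal F^n_k)=\prod_{i=1}^{a(n)}K[\theta^n_k]_{x_i,y_i};$$ $\mathcal F^n_{k+1}=\mathcal F^n_k\vee\sigma(X^{1,n}_{k+1},\dots,X^{a(n),n}_{k+1})$; and $\theta^n_{k+1}=(1-\gamma_{k+1})\theta^n_k+\gamma_{k+1}\frac1{a(n)}\sum_{i=1}^{a(n)}\delta_{X^{i,n}_{k+1}}$. Nothing is assumed about the joint law for different values of $n$. *)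

theory Defs
  imports "HOL-Probability.Probability"
begin

text \<open>
  The transient states \<open>\<Delta>\<^sup>o\<close> are the elements of a finite (hence nonempty) type \<open>'d\<close>.
  The full state space \<open>\<Delta> = \<Delta>\<^sup>o \<union> {0}\<close> is \<open>'d option\<close>, with \<open>None\<close> as the absorbing state \<open>0\<close>.
  A transition matrix on \<open>\<Delta>\<close> is a map \<open>P\<close> sending each state to a probability mass function:
  \<open>P\<^bsub>x,y\<^esub> = pmf (P x) y\<close>.
\<close>

text \<open>Law of \<open>Y\<^sub>n\<close> when \<open>Y\<^sub>0\<close> has law \<open>\<mu>\<close>.\<close>

primrec chain_law :: "('s \<Rightarrow> 's pmf) \<Rightarrow> 's pmf \<Rightarrow> nat \<Rightarrow> 's pmf" where
  "chain_law P \<mu> 0 = \<mu>"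
| "chain_law P \<mu> (Suc n) = bind_pmf (chain_law P \<mu> n) P"

definition irreducible_class :: "('s \<Rightarrow> 's pmf) \<Rightarrow> 's set \<Rightarrow> bool" where
  "irreducible_class P C \<longleftrightarrow>
     (\<forall>x\<in>C. \<forall>y\<in>C. \<exists>n. pmf (chain_law P (return_pmf x) n) y > 0)"

text \<open>
  If the event \<open>Y\<^sub>n \<in> \<Delta>\<^sup>o\<close> has probability \<open>0\<close> for some \<open>n\<close>, the library's conditional
  probability is \<open>0\<close> and \<open>\<mu>\<close> is not a QSD. The case \<open>n = 0\<close> holds for every \<open>\<mu>\<close>.
\<close>

definition quasi_stationary :: "('d option \<Rightarrow> 'd option pmf) \<Rightarrow> 'd pmf \<Rightarrow> bool" where
  "quasi_stationary P \<mu> \<longleftrightarrow>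
     (\<forall>n x. \<P>(y in measure_pmf (chain_law P (map_pmf Some \<mu>) n). y = Some x \<bar> y \<noteq> None)
            = pmf \<mu> x)"

text \<open>
  Identification of probability measures on \<open>\<Delta>\<^sup>o\<close> with points of the simplex. In particular
  the point mass at \<open>x\<close> is \<open>axis x 1\<close>.
\<close>

definition prob_vec :: "'d::finite pmf \<Rightarrow> real ^ 'd" where
  "prob_vec \<mu> = (\<chi> x. pmf \<mu> x)"

lemma prob_vec_return_pmf: "prob_vec (return_pmf x) = axis x 1"
  by (simp add: prob_vec_def axis_def vec_eq_iff indicator_def)

definition is_norm :: "('v::real_vector \<Rightarrow> real) \<Rightarrow> bool" where
  "is_norm N \<longleftrightarrow>
     (\<forall>v. N v \<ge> 0) \<and> (\<forall>v. N v = 0 \<longleftrightarrow> v = 0) \<and>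
     (\<forall>c v. N (c *\<^sub>R v) = \<bar>c\<bar> * N v) \<and> (\<forall>v w. N (v + w) \<le> N v + N w)"

definition K :: "('d::finite option \<Rightarrow> 'd option pmf) \<Rightarrow> real ^ 'd \<Rightarrow> 'd \<Rightarrow> 'd \<Rightarrow> real" where
  "K P \<nu> x y = pmf (P (Some x)) (Some y) + pmf (P (Some x)) None * \<nu> $ y"

text \<open>
  \<open>step_size g k\<close> is \<open>\<gamma>\<^sub>k\<close> for \<open>k \<ge> 1\<close> and \<open>g = \<gamma>\<^sub>*\<close>, so that
  \<open>\<gamma>\<^bsub>k+1\<^esub> = \<gamma>\<^sub>* / (k + N\<^sub>*)\<close> with \<open>N\<^sub>* = \<lfloor>\<gamma>\<^sub>*\<rfloor> + 1\<close>.
\<close>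

definition step_size :: "real \<Rightarrow> nat \<Rightarrow> real" where
  "step_size g k = g / ((real k - 1) + (of_int \<lfloor>g\<rfloor> + 1))"

text \<open>
  Algorithm I for one value of \<open>n\<close>, with \<open>N = a(n)\<close> particles: \<open>X i k\<close> is the position of
  particle \<open>i \<in> {1..N}\<close> at time \<open>k\<close>. The conditional probability given \<open>F k\<close> is the
  conditional expectation of the indicator and is hence specified only almost everywhere.
\<close>

definition algorithm_I ::
  "'w measure \<Rightarrow> ('d::finite option \<Rightarrow> 'd option pmf) \<Rightarrow> real \<Rightarrow> 'd \<Rightarrow> nat \<Rightarrow>
   (nat \<Rightarrow> nat \<Rightarrow> 'w \<Rightarrow> 'd) \<Rightarrow> (nat \<Rightarrow> 'w \<Rightarrow> real ^ 'd) \<Rightarrow> (nat \<Rightarrow> 'w measure) \<Rightarrow> bool" where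
  "algorithm_I M P g x\<^sub>0 N X \<theta> F \<longleftrightarrow>
     (\<forall>i\<in>{1..N}. \<forall>k. X i k \<in> M \<rightarrow>\<^sub>M count_space UNIV) \<and>
     (\<forall>i\<in>{1..N}. \<forall>\<omega>\<in>space M. X i 0 \<omega> = x\<^sub>0) \<and>
     (\<forall>\<omega>\<in>space M. \<theta> 0 \<omega> = axis x\<^sub>0 1) \<and>
     F 0 = sigma (space M) {} \<and>
     (\<forall>k x y. AE \<omega> in M. (\<forall>i\<in>{1..N}. X i k \<omega> = x i) \<longrightarrow>
        real_cond_exp M (F k) (indicator {\<omega>\<in>space M. \<forall>i\<in>{1..N}. X i (Suc k) \<omega> = y i}) \<omega>
          = (\<Prod>i\<in>{1..N}. K P (\<theta> k \<omega>) (x i) (y i))) \<and>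
     (\<forall>k. F (Suc k) = sigma (space M)
        (sets (F k) \<union> {X i (Suc k) -` A \<inter> space M | i A. i \<in> {1..N}})) \<and>
     (\<forall>k. \<forall>\<omega>\<in>space M. \<theta> (Suc k) \<omega> =
        (1 - step_size g (Suc k)) *\<^sub>R \<theta> k \<omega> +
        step_size g (Suc k) *\<^sub>R ((1 / real N) *\<^sub>R (\<Sum>i\<in>{1..N}. axis (X i (Suc k) \<omega>) 1)))"

end

theory Submission
  imports Defs "HOL-Real_Asymp.Real_Asymp"
begin

text \<open>
  The number of particles plays no role: if \<open>m\<^sub>k\<close> is the empirical measure of the particles, then
  \<open>m\<^sub>k\<^sub>+\<^sub>1 = m\<^sub>k Q + (m\<^sub>k \<bullet> \<kappa>) \<theta>\<^sub>k + \<epsilon>\<^sub>k\<^sub>+\<^sub>1\<close> with bounded martingale increments \<open>\<epsilon>\<close>, where \<open>Q\<close> is \<open>P\<close>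
  restricted to the transient states and \<open>\<kappa>\<close> the vector of killing probabilities. Multiplying by
  \<open>G = (1 - Q)\<^sup>-\<^sup>1\<close>, an entrywise positive matrix, gives
  \<open>\<theta>\<^sub>k\<^sub>+\<^sub>1 - \<theta>\<^sub>k = \<gamma>\<^sub>k\<^sub>+\<^sub>1 \<theta>\<^sub>k (c\<^sub>k G - 1) + (T\<^sub>k\<^sub>+\<^sub>1 - T\<^sub>k)\<close>, where \<open>c\<^sub>k = m\<^sub>k \<bullet> \<kappa>\<close> is a scalar and \<open>T\<close>
  consists of a martingale and telescoping terms. The matrices \<open>c\<^sub>k G - 1\<close> commute and share the
  Perron eigenvectors of \<open>G\<close>, the left one being the quasi-stationary distribution. Let \<open>u\<close> be the
  component of \<open>\<theta> - (T - T\<^sub>J)\<close> along it and \<open>v\<close> a norm of the remaining component. Since \<open>G\<close> contracts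
  the latter by an extra factor \<open>1 - \<delta>\<close>, the quotient \<open>v / u\<^sup>1\<^sup>-\<^sup>\<delta>\<close> decays by \<open>exp (- \<delta> \<gamma> / 2)\<close> in each
  step, whatever the \<open>c\<^sub>k\<close> are. Azuma's inequality makes the failure probabilities smaller than every
  power of \<open>n\<close>, and the Borel-Cantelli lemma concludes.
\<close>

section \<open>Perron eigenvectors and the Green matrix\<close>

text \<open>Pairing with \<open>t\<close> turns subinvariance into
  \<open>t \<bullet> v \<le> l * (t \<bullet> v)\<close>, and for \<open>l < 1\<close> this leaves
  no room for nonnegative mass. The positive left eigenvector thus replaces a spectral radius
  argument.\<close>

lemma nonneg_subinvariant_eq_0:
  fixes Q :: "real^'d^'d" and t v :: "real^'d"
  assumes t: "\<And>x. t $ x > 0" and tQ: "t v* Q = l *\<^sub>R t" and l: "l < 1"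
    and v: "\<And>x. 0 \<le> v $ x" "\<And>x. v $ x \<le> (Q *v v) $ x"
  shows "v = 0"
proof -
  have "t \<bullet> v \<le> t \<bullet> (Q *v v)"
    unfolding inner_vec_def by (intro sum_mono) (simp add: mult_left_mono less_imp_le[OF t] v)
  also have "\<dots> = l * (t \<bullet> v)"
    by (simp add: tQ flip: dot_lmul_matrix)
  finally have "(1 - l) * (t \<bullet> v) \<le> 0" by (simp add: algebra_simps)
  with l have "t \<bullet> v \<le> 0" by (simp add: mult_le_0_iff)
  moreover have "0 \<le> t $ x * v $ x" for x using t[of x] v(1)[of x] by simp
  ultimately have "\<forall>x. t $ x * v $ x = 0"
    unfolding inner_vec_def using sum_nonneg_0[of UNIV "\<lambda>x. t $ x * v $ x"]
    by (metis (no_types, lifting) finite_class.finite_UNIV inner_real_def iso_tuple_UNIV_I order_antisym sum.cong sum_nonneg)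
  then show ?thesis using t by (simp add: vec_eq_iff) (metis less_irrefl)
qed

lemma abs_matrix_vector_mult_le:
  fixes Q :: "real^'n^'m"
  assumes "\<And>x y. 0 \<le> Q $ x $ y"
  shows "\<bar>(Q *v v) $ x\<bar> \<le> (Q *v (\<chi> y. \<bar>v $ y\<bar>)) $ x"
  unfolding matrix_vector_mult_def
  by (simp, rule order_trans[OF sum_abs]) (simp add: abs_mult assms)

text \<open>A part of Perron-Frobenius obtained without compactness: \<open>l\<close> is an
  eigenvalue of the transpose, hence of \<open>Q\<close>. The entrywise absolute value
  \<open>h\<close> of an eigenvector satisfies \<open>l * h \<le> Q *v h\<close>, and pairing the
  defect with the positive \<open>t\<close> gives 0, so the defect vanishes.\<close>

lemma right_eigenvector_nonneg:
  fixes Q :: "real^'d^'d" and t :: "real^'d"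
  assumes Q: "\<And>x y. 0 \<le> Q $ x $ y" and t: "\<And>x. t $ x > 0" and tQ: "t v* Q = l *\<^sub>R t"
    and l: "0 \<le> l"
  obtains h where "h \<noteq> 0" "\<And>x. 0 \<le> h $ x" "Q *v h = l *\<^sub>R h"
proof -
  define A where "A = l *\<^sub>R mat 1 - Q"
  have "transpose A *v t = 0"
    by (simp only: A_def transpose_matrix_vector vector_matrix_mult_diff_rdistrib
        vector_scaleR_matrix_ac tQ vector_matrix_mul_rid diff_self)
  moreover have "t \<noteq> 0" using t[of undefined] by auto
  ultimately have "\<not> invertible (transpose A)"
    using matrix_left_invertible_ker[of "transpose A"] by (auto simp: invertible_def)
  then have "\<not> invertible A" by (simp add: invertible_det_nz det_transpose)
  then obtain k where k: "k \<noteq> 0" "A *v k = 0"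
    by (metis invertible_left_inverse matrix_left_invertible_ker)
  have Qk: "Q *v k = l *\<^sub>R k"
    using k(2) by (simp add: A_def matrix_vector_mult_diff_rdistrib scaleR_matrix_vector_assoc[symmetric])
  define h where "h = (\<chi> x. \<bar>k $ x\<bar>)"
  have le: "l * h $ x \<le> (Q *v h) $ x" for x
    using abs_matrix_vector_mult_le[of Q k x] Q Qk l by (simp add: h_def abs_mult)
  have "t \<bullet> (Q *v h - l *\<^sub>R h) = 0"
    using tQ by (simp add: inner_diff_right flip: dot_lmul_matrix)
  then have "(\<Sum>x\<in>UNIV. t $ x * ((Q *v h) $ x - l * h $ x)) = 0"
    by (simp add: inner_vec_def)
  then have "\<forall>x. t $ x * ((Q *v h) $ x - l * h $ x) = 0"
    by (subst (asm) sum_nonneg_eq_0_iff) (auto intro!: mult_nonneg_nonneg simp: le less_imp_le[OF t])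
  then have "Q *v h = l *\<^sub>R h" using t by (simp add: vec_eq_iff) (metis less_irrefl)
  moreover have "h \<noteq> 0" using k(1) by (auto simp: h_def vec_eq_iff)
  ultimately show ?thesis by (intro that[of h]) (auto simp: h_def)
qed

text \<open>\<open>G\<close> is the Green matrix, formally the sum of all powers of
  \<open>Q\<close>. Invertibility and nonnegativity both follow from
  \<open>nonneg_subinvariant_eq_0\<close>; strict positivity comes from \<open>irr\<close>, which is
  irreducibility in terms of closed sets.\<close>

lemma green_matrix_pos:
  fixes Q :: "real^'d^'d" and t :: "real^'d"
  assumes Q: "\<And>x y. 0 \<le> Q $ x $ y" and t: "\<And>x. t $ x > 0" and tQ: "t v* Q = l *\<^sub>R t"
    and l: "l < 1"
    and irr: "\<And>S. S \<noteq> {} \<Longrightarrow> (\<And>x y. x \<in> S \<Longrightarrow> Q $ x $ y > 0 \<Longrightarrow> y \<in> S) \<Longrightarrow> S = UNIV"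
  obtains G where "(mat 1 - Q) ** G = mat 1" "G ** (mat 1 - Q) = mat 1" "\<And>x y. G $ x $ y > 0"
proof -
  have "v = 0" if "(mat 1 - Q) *v v = 0" for v
  proof -
    have "Q *v v = v" using that by (simp add: matrix_vector_mult_diff_rdistrib)
    then have "(\<chi> x. \<bar>v $ x\<bar>) = (0::real^'d)"
      using abs_matrix_vector_mult_le[of Q v, OF Q]
      by (intro nonneg_subinvariant_eq_0[OF t tQ l]) auto
    then show ?thesis by (simp add: vec_eq_iff)
  qed
  then obtain G where G: "(mat 1 - Q) ** G = mat 1" "G ** (mat 1 - Q) = mat 1"
    by (metis invertible_left_inverse matrix_left_invertible_ker invertible_def)
  have "G $ x $ y > 0" for x y
  proof -
    define v where "v = G *v axis y 1"
    have vx: "v $ x = G $ x $ y" for x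
      by (simp add: v_def matrix_vector_mul_component inner_axis)
    have "(mat 1 - Q) *v v = axis y 1"
      by (simp add: v_def matrix_vector_mul_assoc G)
    then have v: "v = axis y 1 + Q *v v" 
      by (simp add: matrix_vector_mult_diff_rdistrib algebra_simps)
    have vx': "v $ x = (if x = y then 1 else 0) + (Q *v v) $ x" for x
      by (subst v) (simp add: axis_def)
    \<comment> \<open>The column \<open>v\<close> solves \<open>v = axis y 1 + Q *v v\<close>, so
      its negative part \<open>n\<close> is subinvariant and must vanish.\<close>
    define n where "n = (\<chi> x. max 0 (- v $ x))"
    have "n = 0"
    proof (rule nonneg_subinvariant_eq_0[OF t tQ l])
      fix x
      have "- (Q *v v) $ x \<le> (Q *v n) $ x"
        unfolding matrix_vector_mult_def n_def
        by (simp, subst sum_negf[symmetric], intro sum_mono)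
          (metis Q max.cobounded2 mult_left_mono mult_minus_right)
      moreover have "0 \<le> (Q *v n) $ x"
        unfolding matrix_vector_mult_def n_def by (auto intro!: sum_nonneg simp: Q)
      ultimately show "n $ x \<le> (Q *v n) $ x"
        using vx'[of x] by (auto simp: n_def split: if_splits)
    qed (simp add: n_def)
    then have v0: "0 \<le> v $ x" for x
      using max.cobounded2[of "- v $ x" 0] by (simp add: n_def vec_eq_iff)

    have Qv0: "0 \<le> (Q *v v) $ x" for x
      unfolding matrix_vector_mult_def by (auto intro!: sum_nonneg simp: Q v0)
    \<comment> \<open>From a zero of \<open>v\<close> every positive transition leads to another
      zero. A nonempty zero set would therefore be everything, although
      \<open>v $ y \<ge> 1\<close>.\<close>
    have "{x. v $ x = 0} = {}"
    proof (rule ccontr)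
      assume *: "{x. v $ x = 0} \<noteq> {}"
      have "{x. v $ x = 0} = UNIV"
      proof (rule irr[OF *])
        fix x z assume x: "x \<in> {x. v $ x = 0}" "Q $ x $ z > 0"
        then have "(Q *v v) $ x = 0" using vx'[of x] Qv0[of x] by (auto split: if_splits)
        then have "\<forall>z. Q $ x $ z * v $ z = 0"
          unfolding matrix_vector_mult_def
          by (simp, subst (asm) sum_nonneg_eq_0_iff) (auto simp: Q v0)
        then have "Q $ x $ z * v $ z = 0" by blast
        then show "z \<in> {x. v $ x = 0}" using x(2) by simp
      qed
      then have "v $ y = 0" by auto
      then show False using vx'[of y] Qv0[of y] by simp
    qed
    then have "v $ x \<noteq> 0" by blast
    then show ?thesis using v0[of x] vx[of x] by simp
  qed
  with G show ?thesis by (rule that)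
qed

section \<open>Deterministic perturbed recursion\<close>

text \<open>The damping factor \<open>c\<close> cancels in the exponent: this is why \<open>v\<close> is compared with the power
  \<open>1 - \<delta>\<close> of \<open>u\<close>.\<close>

lemma lyapunov_step:
  fixes u u' v v' c r \<delta> \<gamma> \<tau> A B lo :: real
  assumes \<delta>: "0 < \<delta>" "\<delta> < 1" and lo: "0 < lo" "lo \<le> u" "lo \<le> u'"
    and \<gamma>: "0 \<le> \<gamma>" "\<gamma> * B \<le> 1 / 2" and B: "B = r + 1 + A / lo"
    and small: "A * \<tau> / lo + 2 * \<gamma> * B\<^sup>2 \<le> \<delta> / 2"
    and \<tau>: "0 \<le> \<tau>" "\<tau> \<le> 1" and A: "0 \<le> A" and r: "0 \<le> r" and c: "0 \<le> c" "c \<le> 1"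
    and v: "0 \<le> v"
    and u': "\<bar>u' - u - \<gamma> * (c * r - 1) * u\<bar> \<le> \<gamma> * A * \<tau>"
    and v': "v' \<le> (1 - \<gamma> + \<gamma> * c * r * (1 - \<delta>)) * v + \<gamma> * A * \<tau>"
  shows "v' * u' powr (- (1 - \<delta>)) \<le>
    exp (- \<delta> * \<gamma> / 2) * (v * u powr (- (1 - \<delta>))) + \<gamma> * (A * lo powr (- (1 - \<delta>))) * \<tau>"
proof -
  \<comment> \<open>\<open>x\<close> is the relative increment of \<open>u\<close>; passing from
    \<open>u\<close> to \<open>u'\<close> multiplies the power \<open>- a\<close> by
    \<open>exp (- a * ln (1 + x))\<close>.\<close>
  define a x where "a = 1 - \<delta>" and "x = u' / u - 1"
  have a: "0 < a" "a < 1" using \<delta> by (auto simp: a_def)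
  have u: "0 < u" "0 < u'" using lo by auto
  have "\<bar>x - \<gamma> * (c * r - 1)\<bar> = \<bar>u' - u - \<gamma> * (c * r - 1) * u\<bar> / u"
  proof -
    have "x - \<gamma> * (c * r - 1) = (u' - u - \<gamma> * (c * r - 1) * u) / u"
      using u by (simp add: x_def field_simps)
    then show ?thesis using u by (simp only: abs_divide abs_of_pos)
  qed
  also have "\<dots> \<le> (\<gamma> * A * \<tau>) / lo"
    by (intro frac_le u') (use lo \<gamma> A \<tau> in auto)
  finally have xb: "\<bar>x - \<gamma> * (c * r - 1)\<bar> \<le> \<gamma> * (A * \<tau> / lo)" by (simp add: mult.assoc)
  have cr: "0 \<le> c * r" "c * r \<le> r" using c r by (auto simp: mult_left_le_one_le)
  have "\<bar>x\<bar> \<le> \<bar>\<gamma> * (c * r - 1)\<bar> + \<gamma> * (A * \<tau> / lo)" using xb by linarith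
  also have "\<dots> = \<gamma> * (\<bar>c * r - 1\<bar> + A * \<tau> / lo)" using \<gamma> by (simp only: abs_mult distrib_left abs_of_nonneg)
  also have "\<dots> \<le> \<gamma> * B"
  proof (rule mult_left_mono)
    have "A * \<tau> / lo \<le> A / lo" using A \<tau> lo by (intro divide_right_mono) (auto simp: mult_left_le)
    then show "\<bar>c * r - 1\<bar> + A * \<tau> / lo \<le> B" unfolding B using cr by linarith
  qed (use \<gamma> in auto)
  finally have xB: "\<bar>x\<bar> \<le> \<gamma> * B" .
  then have x: "\<bar>x\<bar> \<le> 1 / 2" using \<gamma> by linarith
  have "\<bar>ln (1 + x) - x\<bar> \<le> 2 * x\<^sup>2" by (rule abs_ln_one_plus_x_minus_x_bound[OF x])
  then have ln: "ln (1 + x) \<ge> x - 2 * (\<gamma> * B)\<^sup>2"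
    using power_mono[OF xB, of 2] by simp
  have "u' = u * (1 + x)" "0 < 1 + x" using u x by (auto simp: x_def)
  then have "ln u' = ln u + ln (1 + x)" using u by (simp only: ln_mult_pos)
  then have pu': "u' powr (- a) = u powr (- a) * exp (- a * ln (1 + x))"
    using u by (simp add: powr_def distrib_left flip: exp_add)
  have y: "1 - \<gamma> + \<gamma> * c * r * a \<le> exp (- \<gamma> + \<gamma> * c * r * a)"
    using exp_ge_add_one_self[of "- \<gamma> + \<gamma> * c * r * a"] by linarith
  \<comment> \<open>Since \<open>x\<close> is close to \<open>\<gamma> * (c * r - 1)\<close>, the
    term \<open>\<gamma> * c * r * a\<close> cancels. What remains is
    \<open>- \<gamma> + a * \<gamma> = - \<delta> * \<gamma>\<close>, and \<open>small\<close> lets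
    the errors consume at most half of it.\<close>
  have "- \<gamma> + \<gamma> * c * r * a - a * ln (1 + x) \<le> - \<gamma> + \<gamma> * c * r * a - a * (x - 2 * (\<gamma> * B)\<^sup>2)"
    using ln a by (simp add: mult_left_mono)
  also have "\<dots> = - \<delta> * \<gamma> + a * (\<gamma> * (c * r - 1) - x) + a * (2 * (\<gamma> * B)\<^sup>2)"
    by (simp add: a_def algebra_simps)
  also have "\<dots> \<le> - \<delta> * \<gamma> + a * (\<gamma> * (A * \<tau> / lo)) + a * (2 * (\<gamma> * B)\<^sup>2)"
    using xb a by (intro add_mono order_refl mult_left_mono) auto
  also have "\<dots> = - \<delta> * \<gamma> + a * (\<gamma> * (A * \<tau> / lo + 2 * \<gamma> * B\<^sup>2))"
    by (simp add: power2_eq_square algebra_simps)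
  also have "\<dots> \<le> - \<delta> * \<gamma> + 1 * (\<gamma> * (\<delta> / 2))"
    using small a \<gamma> A lo \<tau> by (intro add_mono order_refl mult_mono) auto
  also have "\<dots> = - \<delta> * \<gamma> / 2" by simp
  finally have ex: "exp (- \<gamma> + \<gamma> * c * r * a - a * ln (1 + x)) \<le> exp (- \<delta> * \<gamma> / 2)" by simp
  have "v' * u' powr (- a) \<le> ((1 - \<gamma> + \<gamma> * c * r * a) * v + \<gamma> * A * \<tau>) * u' powr (- a)"
    using v' by (intro mult_right_mono) (auto simp: a_def)
  also have "\<dots> = (1 - \<gamma> + \<gamma> * c * r * a) * v * u' powr (- a) + \<gamma> * A * \<tau> * u' powr (- a)"
    by (simp add: distrib_right)
  also have "\<dots> \<le> exp (- \<delta> * \<gamma> / 2) * (v * u powr (- a)) + \<gamma> * A * \<tau> * lo powr (- a)"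
  proof (rule add_mono)
    have "(1 - \<gamma> + \<gamma> * c * r * a) * v * u' powr (- a)
      \<le> exp (- \<gamma> + \<gamma> * c * r * a) * v * u' powr (- a)"
      using y v by (intro mult_right_mono) auto
    also have "\<dots> = exp (- \<gamma> + \<gamma> * c * r * a - a * ln (1 + x)) * (v * u powr (- a))"
      unfolding pu' by (simp add: exp_diff exp_minus divide_inverse)
    also have "\<dots> \<le> exp (- \<delta> * \<gamma> / 2) * (v * u powr (- a))"
      using ex v by (intro mult_right_mono) auto
    finally show "(1 - \<gamma> + \<gamma> * c * r * a) * v * u' powr (- a) \<le> exp (- \<delta> * \<gamma> / 2) * (v * u powr (- a))" .
    show "\<gamma> * A * \<tau> * u' powr (- a) \<le> \<gamma> * A * \<tau> * lo powr (- a)"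
      using a lo \<gamma> A \<tau> by (intro mult_left_mono powr_mono2') auto
  qed
  finally show ?thesis by (simp add: a_def mult_ac)
qed

text \<open>A discrete Gronwall bound. The exponential factor is estimated in two ways: by a ratio
  of powers, which telescopes, for the initial value, and by \<open>1 - z / 2\<close> with
  \<open>z = b / (j + n0)\<close> for the forcing, since
  \<open>(1 - z / 2) * (2 * C) + z * C = 2 * C\<close>.\<close>

lemma harmonic_decay_step:
  fixes L :: "nat \<Rightarrow> real"
  assumes n0: "0 < n0" and b: "0 < b" "b \<le> real J + n0" and C: "0 \<le> C" "0 \<le> L J"
    and jk: "J \<le> k"
    and step: "\<And>j. J \<le> j \<Longrightarrow> j < k \<Longrightarrow> L (Suc j) \<le> exp (- (b / (real j + n0))) * L j + b / (real j + n0) * C"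
  shows "L k \<le> L J * ((real J + n0) / (real k + n0)) powr b + 2 * C"
  using jk step
proof (induction k rule: dec_induct)
  case base
  then show ?case using n0 C by simp
next
  case (step j)
  define m where "m = real j + n0"
  have m: "m > 0" "b \<le> m" using n0 b step.hyps by (auto simp: m_def)
  have "ln ((m + 1) / m) \<le> 1 / m"
    using ln_le_minus_one[of "(m + 1) / m"] m by (simp add: field_simps)
  then have "ln (m / (m + 1)) \<ge> - (1 / m)" using m by (simp add: ln_div)
  then have "exp (- (b / m)) \<le> exp (b * ln (m / (m + 1)))"
    using mult_left_mono[of "- (1/m)" "ln (m / (m + 1))" b] b by simp
  then have 1: "exp (- (b / m)) \<le> (m / (m + 1)) powr b" using m by (simp add: powr_def)
  \<comment> \<open>For \<open>0 \<le> z \<le> 1\<close> one has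
    \<open>exp (- z) * (1 + z) \<le> 1 \<le> (1 - z / 2) * (1 + z)\<close>; here
    \<open>b \<le> real J + n0\<close> ensures \<open>z \<le> 1\<close>.\<close>
  have "exp (- (b / m)) * (1 + b / m) \<le> exp (- (b / m)) * exp (b / m)"
    using exp_ge_add_one_self[of "b / m"] by (intro mult_left_mono) auto
  then have "exp (- (b / m)) * (1 + b / m) \<le> 1" by (simp flip: exp_add)
  moreover have "1 \<le> (1 - b / m / 2) * (1 + b / m)"
  proof -
    have "z * z \<le> z \<Longrightarrow> 1 \<le> (1 - z / 2) * (1 + z)" for z :: real
      by (simp add: algebra_simps)
    moreover have "(b / m) * (b / m) \<le> b / m" using m b by (intro mult_left_le) auto
    ultimately show ?thesis by blast
  qed
  ultimately have "exp (- (b / m)) * (1 + b / m) \<le> (1 - b / m / 2) * (1 + b / m)" by linarith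
  moreover have "0 < 1 + b / m" using b m by (simp add: add_pos_pos)
  ultimately have 2: "exp (- (b / m)) \<le> 1 - b / m / 2" by (simp only: mult_le_cancel_right_pos)
  define q where "q = ((real J + n0) / m) powr b"
  have q0: "0 \<le> L J * q" using C by (simp add: q_def)
  have IH: "L j \<le> L J * q + 2 * C" using step by (simp add: q_def m_def)
  have "L (Suc j) \<le> exp (- (b / m)) * L j + b / m * C" using step by (simp add: m_def)
  also have "\<dots> \<le> exp (- (b / m)) * (L J * q + 2 * C) + b / m * C"
    using IH by simp
  also have "\<dots> \<le> (m / (m + 1)) powr b * (L J * q) + (1 - b / m / 2) * (2 * C) + b / m * C"
    using 1 2 C q0 by (auto simp: distrib_left intro!: add_mono mult_right_mono)
  also have "\<dots> = L J * ((m / (m + 1)) powr b * q) + 2 * C" by (simp add: algebra_simps)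
  also have "(m / (m + 1)) powr b * q = ((real J + n0) / (real (Suc j) + n0)) powr b"
    unfolding q_def using m n0 by (simp add: m_def add_ac flip: powr_mult)
  finally show ?case .
qed

section \<open>Contraction transverse to the Perron eigenvector, and the perturbed recursion\<close>

locale perron_matrix =
  fixes G :: "real^'d^'d" and h t :: "real^'d" and r \<delta> :: real
  assumes h_pos: "\<And>x. h $ x > 0" and t_pos: "\<And>x. t $ x > 0" and r_pos: "r > 0"
    and \<delta>: "0 < \<delta>" "\<delta> < 1"
    and Gh: "G *v h = r *\<^sub>R h" and tG: "t v* G = r *\<^sub>R t"
    and th: "t \<bullet> h = 1" and t_sum: "(\<Sum>x\<in>UNIV. t $ x) = 1"
    and minor: "\<And>x y. \<delta> * r * h $ x * t $ y \<le> G $ x $ y"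
begin

text \<open>The weight makes the norm fit \<open>G\<close>: on nonnegative vectors it equals the
  linear functional \<open>w \<bullet> h\<close>, which \<open>G\<close> multiplies by exactly
  \<open>r\<close>.\<close>

definition hnorm :: "real^'d \<Rightarrow> real" where "hnorm w = (\<Sum>x\<in>UNIV. \<bar>w $ x\<bar> * h $ x)"

lemma hnorm_nonneg: "0 \<le> hnorm w"
  unfolding hnorm_def by (intro sum_nonneg) (simp add: less_imp_le[OF h_pos])

lemma hnorm_add: "hnorm (v + w) \<le> hnorm v + hnorm w"
  unfolding hnorm_def sum.distrib[symmetric]
  by (intro sum_mono) (simp add: less_imp_le[OF h_pos] abs_triangle_ineq mult_right_mono flip: distrib_right)

lemma hnorm_scaleR: "hnorm (c *\<^sub>R v) = \<bar>c\<bar> * hnorm v"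
  unfolding hnorm_def by (simp add: abs_mult sum_distrib_left mult.assoc)

lemma hnorm_minus: "hnorm (- v) = hnorm v"
  unfolding hnorm_def by simp

lemma hnorm_diff: "hnorm (v - w) \<le> hnorm v + hnorm w"
  using hnorm_add[of v "- w"] by (simp add: hnorm_minus)

lemma hnorm_t: "hnorm t = 1"
  using th by (simp add: hnorm_def inner_vec_def abs_of_pos[OF t_pos])

lemma abs_inner_h_le: "\<bar>w \<bullet> h\<bar> \<le> hnorm w"
  unfolding hnorm_def inner_vec_def
  by (rule order_trans[OF sum_abs]) (simp add: abs_mult abs_of_pos[OF h_pos])

lemma hnorm_le_norm: "hnorm w \<le> (\<Sum>x\<in>UNIV. h $ x) * norm w"
  unfolding hnorm_def sum_distrib_right
  by (intro sum_mono) (metis component_le_norm_cart h_pos less_imp_le mult.commute mult_left_mono)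

lemma norm_le_hnorm: "norm w \<le> (\<Sum>x\<in>UNIV. 1 / h $ x) * hnorm w"
proof -
  have "\<bar>w $ x\<bar> \<le> 1 / h $ x * hnorm w" for x
  proof -
    have "\<bar>w $ x\<bar> * h $ x \<le> hnorm w"
      unfolding hnorm_def by (rule member_le_sum) (simp_all add: less_imp_le[OF h_pos])
    then show ?thesis using h_pos[of x] by (simp add: field_simps)
  qed
  then have "(\<Sum>x\<in>UNIV. \<bar>w $ x\<bar>) \<le> (\<Sum>x\<in>UNIV. 1 / h $ x * hnorm w)" by (intro sum_mono)
  then show ?thesis using norm_le_l1_cart[of w] by (simp add: sum_distrib_right)
qed

text \<open>A Doeblin argument. The rank-one matrix with entries
  \<open>e * r * h $ x * t $ y\<close> does not act on \<open>w\<close>, so it may be subtracted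
  from \<open>G\<close>. The rest is entrywise nonnegative and has \<open>h\<close> as right
  eigenvector for \<open>r * (1 - e)\<close>. The case \<open>e = 0\<close> is the plain bound,
  \<open>e = \<delta>\<close> the spectral gap.\<close>

lemma hnorm_mult_aux:
  assumes w: "w \<bullet> h = 0 \<or> e = 0" and e: "\<And>x y. e * r * h $ x * t $ y \<le> G $ x $ y"
  shows "hnorm (w v* G) \<le> r * (1 - e) * hnorm w"
proof -
  have "\<bar>(w v* G) $ y\<bar> \<le> (\<Sum>x\<in>UNIV. \<bar>w $ x\<bar> * (G $ x $ y - e * r * h $ x * t $ y))" for y
  proof -
    have "(w v* G) $ y = (\<Sum>x\<in>UNIV. w $ x * (G $ x $ y - e * r * h $ x * t $ y)) + e * r * t $ y * (w \<bullet> h)"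
      by (simp add: vector_matrix_mult_def inner_vec_def right_diff_distrib sum_subtractf sum_distrib_left mult_ac)
    then have "(w v* G) $ y = (\<Sum>x\<in>UNIV. w $ x * (G $ x $ y - e * r * h $ x * t $ y))" using w by auto
    then show ?thesis
      by (simp only:) (rule order_trans[OF sum_abs], simp add: abs_mult e)
  qed
  then have "hnorm (w v* G) \<le> (\<Sum>y\<in>UNIV. (\<Sum>x\<in>UNIV. \<bar>w $ x\<bar> * (G $ x $ y - e * r * h $ x * t $ y)) * h $ y)"
    unfolding hnorm_def by (intro sum_mono mult_right_mono) (auto simp: less_imp_le[OF h_pos])
  also have "\<dots> = (\<Sum>x\<in>UNIV. \<bar>w $ x\<bar> * ((\<Sum>y\<in>UNIV. G $ x $ y * h $ y) - e * r * h $ x * (\<Sum>y\<in>UNIV. t $ y * h $ y)))"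
    unfolding sum_distrib_right
    by (subst sum.swap) (simp add: sum_distrib_left right_diff_distrib left_diff_distrib sum_subtractf mult_ac)
  also have "\<dots> = (\<Sum>x\<in>UNIV. \<bar>w $ x\<bar> * (r * h $ x - e * r * h $ x))"
  proof -
    have "(\<Sum>y\<in>UNIV. G $ x $ y * h $ y) = r * h $ x" for x
      using arg_cong[OF Gh, of "\<lambda>v. v $ x"] by (simp add: matrix_vector_mult_def)
    then show ?thesis using th by (simp add: inner_vec_def)
  qed
  also have "\<dots> = r * (1 - e) * hnorm w"
    by (simp add: hnorm_def sum_distrib_left algebra_simps sum_subtractf)
  finally show ?thesis .
qed

lemma hnorm_contract: "w \<bullet> h = 0 \<Longrightarrow> hnorm (w v* G) \<le> r * (1 - \<delta>) * hnorm w"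
  using minor by (intro hnorm_mult_aux) auto

lemma hnorm_mult: "hnorm (w v* G) \<le> r * hnorm w"
proof -
  have "0 \<le> G $ x $ y" for x y
    using order_trans[OF _ minor[of x y], of 0] \<delta> r_pos h_pos[of x] t_pos[of y] by simp
  then show ?thesis using hnorm_mult_aux[of w 0] by simp
qed

text \<open>All constants are obtained before the trajectory, the scalars \<open>c\<close> and the
  perturbation \<open>T\<close> are quantified. Hence the bound is later uniform in the particle
  number, the run and the sample point.\<close>

lemma perturbed_recursion_bound:
  fixes g n0 :: real
  assumes g: "0 < g" and n0: "0 < n0"
  obtains C \<tau>0 b :: real and J0 :: nat where "0 \<le> C" "0 < \<tau>0" "0 < b"
    "\<And>\<theta> c T J k \<tau>. J0 \<le> J \<Longrightarrow> J \<le> k \<Longrightarrow> 0 \<le> \<tau> \<Longrightarrow> \<tau> \<le> \<tau>0 \<Longrightarrow>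
      (\<And>j x. 0 \<le> \<theta> j $ x) \<Longrightarrow> (\<And>j. (\<Sum>x\<in>UNIV. \<theta> j $ x) = 1) \<Longrightarrow>
      (\<And>j. 0 \<le> c j) \<Longrightarrow> (\<And>j. c j \<le> 1) \<Longrightarrow>
      (\<And>j. \<theta> (Suc j) = \<theta> j + (g / (real j + n0)) *\<^sub>R (c j *\<^sub>R (\<theta> j v* G) - \<theta> j) + (T (Suc j) - T j)) \<Longrightarrow>
      (\<And>j. J \<le> j \<Longrightarrow> j \<le> k \<Longrightarrow> norm (T j - T J) \<le> \<tau>) \<Longrightarrow>
      norm (\<theta> k - t) \<le> C * (((real J + n0) / (real k + n0)) powr b + \<tau>)"
proof -
  define H where "H = (\<Sum>x\<in>UNIV. h $ x)"
  define H' where "H' = (\<Sum>x\<in>UNIV. 1 / h $ x)"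
  define hm where "hm = Min (range (($) h))"
  have hm: "0 < hm" "hm \<le> h $ x" for x using h_pos by (auto simp: hm_def)
  have hH: "h $ x \<le> H" for x unfolding H_def by (rule member_le_sum) (auto intro: less_imp_le[OF h_pos])
  have H: "0 < H" using hH[of undefined] h_pos[of undefined] by linarith
  have H': "0 \<le> H'" unfolding H'_def by (intro sum_nonneg) (simp add: less_imp_le[OF h_pos])
  \<comment> \<open>\<open>lo\<close> will bound \<open>u\<close> from below: a probability vector
    has \<open>\<theta> j \<bullet> h \<ge> hm\<close>, and the perturbation may take away half of
    it. \<open>A * \<tau>\<close> will dominate the error both along \<open>t\<close> and transverse
    to it.\<close>
  define lo where "lo = hm / 2"
  define A where "A = 2 * (r + 1) * H"
  define B where "B = r + 1 + A / lo"
  define a where "a = 1 - \<delta>"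
  have a: "0 < a" "a < 1" using \<delta> by (auto simp: a_def)
  have A: "0 < A" using H r_pos by (simp add: A_def)
  have lo: "0 < lo" using hm by (simp add: lo_def)
  have B: "1 < B" using r_pos A lo by (simp add: B_def add_pos_pos)
  \<comment> \<open>The bound \<open>lo / H\<close> keeps \<open>u\<close> above \<open>lo\<close>.
    The last entry makes \<open>A * \<tau> / lo \<le> \<delta> / 4\<close>, and
    \<open>\<gamma>0\<close> below makes \<open>2 * \<gamma> * B\<^sup>2 \<le> \<delta> / 4\<close>;
    together they give the smallness required by \<open>lyapunov_step\<close>.\<close>
  define \<tau>0 where "\<tau>0 = min 1 (min (lo / H) (\<delta> / 4 * lo / A))"
  have \<tau>0: "0 < \<tau>0" "\<tau>0 \<le> 1" "\<tau>0 \<le> lo / H" "\<tau>0 \<le> \<delta> / 4 * lo / A" using lo H \<delta> A by (auto simp: \<tau>0_def)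
  define \<gamma>0 where "\<gamma>0 = \<delta> / (8 * B\<^sup>2)"
  have \<gamma>0: "0 < \<gamma>0" using B \<delta> by (simp add: \<gamma>0_def)
  define J0 where "J0 = nat \<lceil>g / \<gamma>0\<rceil>"
  \<comment> \<open>With this \<open>b\<close> the rate \<open>\<delta> * \<gamma> / 2\<close> of
    \<open>lyapunov_step\<close> is \<open>b / (real j + n0)\<close>.\<close>
  define b where "b = \<delta> * g / 2"
  have b: "0 < b" using \<delta> g by (simp add: b_def)
  define hi where "hi = 2 * H"
  \<comment> \<open>\<open>CL\<close> bounds the Lyapunov quotient at time \<open>J\<close>,
    \<open>D\<close> its forcing: the inner \<open>2 / \<delta>\<close> converts step sizes into
    multiples of \<open>b / (real j + n0)\<close>, the outer 2 comes from
    \<open>harmonic_decay_step\<close>.\<close>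
  define CL where "CL = (2 * hi) * lo powr (- a)"
  define D where "D = 2 * (2 * (A * lo powr (- a)) / \<delta>)"
  have CL: "0 \<le> CL" and D: "0 \<le> D" using H A \<delta> by (auto simp: CL_def D_def hi_def)
  define E where "E = max (H' * hi powr a * CL) (H' * hi powr a * D + 1)"
  have E: "0 \<le> E" using H' H CL by (simp add: E_def hi_def le_max_iff_disj)
  define C where "C = E * (1 + real CARD('d) * norm t)"
  have C: "0 \<le> C" using E by (simp add: C_def)
  show ?thesis
  proof (rule that[OF C \<tau>0(1) b, of J0])
    fix \<theta> :: "nat \<Rightarrow> real^'d" and c :: "nat \<Rightarrow> real" and T :: "nat \<Rightarrow> real^'d" and J k :: nat and \<tau> :: real
    assume J: "J0 \<le> J" "J \<le> k" and \<tau>: "0 \<le> \<tau>" "\<tau> \<le> \<tau>0"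
      and \<theta>0: "\<And>j x. 0 \<le> \<theta> j $ x" and \<theta>1: "\<And>j. (\<Sum>x\<in>UNIV. \<theta> j $ x) = 1"
      and c: "\<And>j. 0 \<le> c j" "\<And>j. c j \<le> 1"
      and rec: "\<And>j. \<theta> (Suc j) = \<theta> j + (g / (real j + n0)) *\<^sub>R (c j *\<^sub>R (\<theta> j v* G) - \<theta> j) + (T (Suc j) - T j)"
      and T: "\<And>j. J \<le> j \<Longrightarrow> j \<le> k \<Longrightarrow> norm (T j - T J) \<le> \<tau>"
    define e where "e j = T j - T J" for j
    \<comment> \<open>Subtracting the perturbation accumulated since \<open>J\<close> cancels its
      increments, which need not be small compared with the step size. It survives only in
      \<open>d\<close>, where it carries the factor \<open>\<gamma> j\<close>.\<close>
    define \<eta> where "\<eta> j = \<theta> j - e j" for j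
    define \<gamma> where "\<gamma> j = g / (real j + n0)" for j
    define d where "d j = c j *\<^sub>R (e j v* G) - e j" for j
    define u where "u j = \<eta> j \<bullet> h" for j
    define w where "w j = \<eta> j - u j *\<^sub>R t" for j
    have \<gamma>: "0 < \<gamma> j" for j using g n0 by (simp add: \<gamma>_def)
    have \<gamma>_le: "\<gamma> j \<le> \<gamma>0" if "J \<le> j" for j
    proof -
      have "g / \<gamma>0 \<le> real J0" by (simp add: J0_def real_nat_ceiling_ge)
      also have "\<dots> \<le> real j + n0" using J that n0 by simp
      finally show ?thesis using \<gamma>0 n0 by (simp add: \<gamma>_def field_simps)
    qed
    have \<gamma>B: "\<gamma> j * B \<le> 1 / 2" "\<gamma> j * B\<^sup>2 \<le> \<delta> / 8" "\<gamma> j \<le> 1" if "J \<le> j" for j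
    proof -
      have "\<gamma> j * B\<^sup>2 \<le> \<gamma>0 * B\<^sup>2" using \<gamma>_le[OF that] by (intro mult_right_mono) auto
      also have "\<dots> = \<delta> / 8" using B by (simp add: \<gamma>0_def)
      finally show 1: "\<gamma> j * B\<^sup>2 \<le> \<delta> / 8" .
      have "B * 1 \<le> B * B" using B by (intro mult_left_mono) auto
      then have "\<gamma> j * B \<le> \<gamma> j * B\<^sup>2" "\<gamma> j * 1 \<le> \<gamma> j * B"
        using B less_imp_le[OF \<gamma>[of j]] by (intro mult_left_mono; simp add: power2_eq_square)+
      then show "\<gamma> j * B \<le> 1 / 2" "\<gamma> j \<le> 1" using 1 \<delta> by auto
    qed
    have \<eta>_rec: "\<eta> (Suc j) = \<eta> j + \<gamma> j *\<^sub>R (c j *\<^sub>R (\<eta> j v* G) - \<eta> j) + \<gamma> j *\<^sub>R d j" for j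
      unfolding \<eta>_def d_def rec[of j] e_def \<gamma>_def[symmetric]
      by (simp add: vector_matrix_mult_diff_distrib algebra_simps)
    have u_rec: "u (Suc j) = u j + \<gamma> j * (c j * r - 1) * u j + \<gamma> j * (d j \<bullet> h)" for j
      unfolding u_def \<eta>_rec by (simp add: inner_add_left inner_diff_left dot_lmul_matrix Gh algebra_simps)
    have w_rec: "w (Suc j) = (1 - \<gamma> j) *\<^sub>R w j + (\<gamma> j * c j) *\<^sub>R (w j v* G) + \<gamma> j *\<^sub>R (d j - (d j \<bullet> h) *\<^sub>R t)" for j
      unfolding w_def \<eta>_rec u_rec
      by (simp add: vector_matrix_mult_diff_distrib scaleR_vector_matrix_assoc tG algebra_simps)
    have wh: "w j \<bullet> h = 0" for j by (simp add: w_def inner_diff_left th flip: u_def)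
    have he: "hnorm (e j) \<le> H * \<tau>" if "J \<le> j" "j \<le> k" for j
      using order_trans[OF hnorm_le_norm mult_left_mono[OF T[OF that]]] H by (simp add: e_def H_def)
    have hd: "hnorm (d j) \<le> (r + 1) * (H * \<tau>)" if "J \<le> j" "j \<le> k" for j
    proof -
      have "hnorm (d j) \<le> c j * hnorm (e j v* G) + hnorm (e j)"
        unfolding d_def by (rule order_trans[OF hnorm_diff]) (simp add: hnorm_scaleR c)
      also have "c j * hnorm (e j v* G) \<le> 1 * (r * hnorm (e j))"
        using c hnorm_mult hnorm_nonneg by (intro mult_mono) auto
      finally have "hnorm (d j) \<le> (r + 1) * hnorm (e j)" by (simp add: algebra_simps)
      also have "\<dots> \<le> (r + 1) * (H * \<tau>)" using he[OF that] r_pos by (intro mult_left_mono) auto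
      finally show ?thesis .
    qed
    have "H * \<tau> \<le> H * \<tau>0" using \<tau> H by (intro mult_left_mono) auto
    also have "\<dots> \<le> lo" using \<tau>0(3) H by (simp add: field_simps)
    finally have H\<tau>: "H * \<tau> \<le> lo" .
    have \<theta>h: "hm \<le> \<theta> j \<bullet> h" "\<theta> j \<bullet> h \<le> H" for j
    proof -
      have "(\<Sum>x\<in>UNIV. \<theta> j $ x * hm) \<le> \<theta> j \<bullet> h"
        unfolding inner_vec_def by (intro sum_mono) (simp add: mult_left_mono hm \<theta>0)
      then show "hm \<le> \<theta> j \<bullet> h" by (simp add: \<theta>1 flip: sum_distrib_right)
      have "\<theta> j \<bullet> h \<le> (\<Sum>x\<in>UNIV. \<theta> j $ x * H)"
        unfolding inner_vec_def by (intro sum_mono) (simp add: mult_left_mono hH \<theta>0)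
      then show "\<theta> j \<bullet> h \<le> H" by (simp add: \<theta>1 flip: sum_distrib_right)
    qed
    have u: "lo \<le> u j" "u j \<le> hi" if "J \<le> j" "j \<le> k" for j
    proof -
      have "\<bar>e j \<bullet> h\<bar> \<le> lo" using abs_inner_h_le[of "e j"] he[OF that] H\<tau> by linarith
      moreover have "u j = \<theta> j \<bullet> h - e j \<bullet> h" by (simp add: u_def \<eta>_def inner_diff_left)
      moreover have "hm \<le> H" using hm(2) hH by (rule order_trans)
      ultimately show "lo \<le> u j" "u j \<le> hi" using \<theta>h[of j] hm(1) unfolding lo_def hi_def by linarith+
    qed
    define L where "L j = hnorm (w j) * u j powr (- a)" for j
    have L_step: "L (Suc j) \<le> exp (- (b / (real j + n0))) * L j + b / (real j + n0) * (2 * (A * lo powr (- a)) / \<delta> * \<tau>)"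
      if "J \<le> j" "j < k" for j
    proof -
      have jk: "J \<le> j" "j \<le> k" "J \<le> Suc j" "Suc j \<le> k" using that by auto
      have "L (Suc j) \<le> exp (- \<delta> * \<gamma> j / 2) * (hnorm (w j) * u j powr (- (1 - \<delta>))) + \<gamma> j * (A * lo powr (- (1 - \<delta>))) * \<tau>"
        unfolding L_def a_def
      proof (rule lyapunov_step[where c = "c j" and r = r and B = B])
        have "A * \<tau> \<le> A * \<tau>0" using \<tau> A by (intro mult_left_mono) auto
        also have "\<dots> \<le> \<delta> / 4 * lo" using \<tau>0(4) A by (simp add: field_simps)
        finally have "A * \<tau> \<le> \<delta> / 4 * lo" .
        then have "A * \<tau> / lo \<le> \<delta> / 4" using lo by (simp add: field_simps)
        moreover have "2 * \<gamma> j * B\<^sup>2 = 2 * (\<gamma> j * B\<^sup>2)" by simp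
        ultimately show "A * \<tau> / lo + 2 * \<gamma> j * B\<^sup>2 \<le> \<delta> / 2" using \<gamma>B(2)[OF jk(1)] by linarith
        have "\<bar>d j \<bullet> h\<bar> \<le> (r + 1) * (H * \<tau>)" using abs_inner_h_le[of "d j"] hd[OF jk(1,2)] by linarith
        moreover have A\<tau>: "A * \<tau> = 2 * ((r + 1) * (H * \<tau>))" "0 \<le> (r + 1) * (H * \<tau>)"
          using r_pos H \<tau> by (simp_all add: A_def)
        ultimately have "\<bar>d j \<bullet> h\<bar> \<le> A * \<tau>" by linarith
        then show "\<bar>u (Suc j) - u j - \<gamma> j * (c j * r - 1) * u j\<bar> \<le> \<gamma> j * A * \<tau>"
          using \<gamma>[of j] by (simp add: u_rec abs_mult)
        have "hnorm (d j - (d j \<bullet> h) *\<^sub>R t) \<le> hnorm (d j) + \<bar>d j \<bullet> h\<bar>"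
          by (rule order_trans[OF hnorm_diff]) (simp add: hnorm_scaleR hnorm_t)
        also have "\<dots> \<le> A * \<tau>" using abs_inner_h_le[of "d j"] hd[OF jk(1,2)] A\<tau> by linarith
        finally have d: "hnorm (d j - (d j \<bullet> h) *\<^sub>R t) \<le> A * \<tau>" .
        have "hnorm (w (Suc j)) \<le> (1 - \<gamma> j) * hnorm (w j) + \<gamma> j * c j * hnorm (w j v* G) + \<gamma> j * hnorm (d j - (d j \<bullet> h) *\<^sub>R t)"
          unfolding w_rec
          by (rule order_trans[OF hnorm_add add_mono[OF order_trans[OF hnorm_add]]])
            (use \<gamma>B(3)[OF jk(1)] \<gamma>[of j] c in \<open>auto simp: hnorm_scaleR abs_mult\<close>)
        also have "\<dots> \<le> (1 - \<gamma> j) * hnorm (w j) + \<gamma> j * c j * (r * (1 - \<delta>) * hnorm (w j)) + \<gamma> j * (A * \<tau>)"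
          using \<gamma>[of j] \<gamma>B(3)[OF jk(1)] c[of j] d hnorm_contract[OF wh] by (intro add_mono mult_left_mono) auto
        finally show "hnorm (w (Suc j)) \<le> (1 - \<gamma> j + \<gamma> j * c j * r * (1 - \<delta>)) * hnorm (w j) + \<gamma> j * A * \<tau>"
          by (simp add: algebra_simps)
      qed (use \<delta> lo u jk \<gamma>[of j] \<gamma>B B_def \<tau> \<tau>0 A r_pos c hnorm_nonneg in \<open>auto intro: less_imp_le\<close>)
      moreover have b\<gamma>: "b / (real j + n0) = \<delta> * \<gamma> j / 2" by (simp add: b_def \<gamma>_def)
      moreover have "\<delta> * \<gamma> j / 2 * (2 * y / \<delta> * \<tau>) = \<gamma> j * y * \<tau>" for y
        using \<delta> by (simp add: field_simps)
      ultimately show ?thesis by (simp only: L_def a_def) simp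
    qed
    \<comment> \<open>At time \<open>J\<close> the perturbation \<open>e J\<close> is 0, so
      \<open>w J\<close> is a difference of two nonnegative vectors whose weighted norms are
      known.\<close>
    have L_J: "L J \<le> CL"
    proof -
      have "hnorm (w J) \<le> hnorm (\<theta> J) + hnorm (u J *\<^sub>R t)"
        unfolding w_def by (rule order_trans[OF hnorm_diff]) (simp add: \<eta>_def e_def)
      also have "hnorm (\<theta> J) = \<theta> J \<bullet> h" by (simp add: hnorm_def inner_vec_def \<theta>0)
      also have "hnorm (u J *\<^sub>R t) = u J" using u(1)[of J] lo J by (simp add: hnorm_scaleR hnorm_t)
      also have "\<theta> J \<bullet> h + u J \<le> 2 * hi" using \<theta>h(2)[of J] u(2)[of J] J H unfolding hi_def by linarith
      finally have "hnorm (w J) \<le> 2 * hi" .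
      then show ?thesis unfolding L_def CL_def using a u(1)[of J] J lo H
        by (intro mult_mono powr_mono2') (auto simp: hi_def)
    qed
    have L_nonneg: "0 \<le> L j" for j by (simp add: L_def hnorm_nonneg)
    define q where "q = ((real J + n0) / (real k + n0)) powr b"
    have q: "0 \<le> q" by (simp add: q_def)
    have bJ: "b \<le> real J + n0"
    proof -
      have "\<gamma> J \<le> 1" using \<gamma>B by simp
      then have "g \<le> real J + n0" using n0 by (simp add: \<gamma>_def field_simps)
      moreover have "b \<le> g" using \<delta> g by (simp add: b_def)
      ultimately show ?thesis by simp
    qed
    have "L k \<le> L J * q + 2 * (2 * (A * lo powr (- a)) / \<delta> * \<tau>)"
      unfolding q_def using A \<delta> \<tau> by (intro harmonic_decay_step[OF n0 b bJ _ L_nonneg J(2) L_step]) auto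
    also have "\<dots> \<le> CL * q + D * \<tau>"
      using mult_right_mono[OF L_J q] by (simp add: D_def)
    finally have L_k: "L k \<le> CL * q + D * \<tau>" .
    have uk: "0 < u k" "u k \<le> hi" using u[of k] J lo by auto
    have "hnorm (w k) = L k * u k powr a" using uk by (simp add: L_def powr_minus)
    also have "\<dots> \<le> (CL * q + D * \<tau>) * hi powr a"
      using uk a L_k L_nonneg[of k] by (intro mult_mono powr_mono2) auto
    finally have "norm (w k) \<le> H' * ((CL * q + D * \<tau>) * hi powr a)"
      using order_trans[OF norm_le_hnorm mult_left_mono] H' unfolding H'_def by blast
    then have "norm (w k + e k) \<le> (H' * hi powr a * CL) * q + (H' * hi powr a * D + 1) * \<tau>"
      using norm_triangle_ineq[of "w k" "e k"] T[of k] J by (simp add: e_def algebra_simps)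
    also have "\<dots> \<le> E * q + E * \<tau>"
      using q \<tau> by (intro add_mono mult_right_mono) (auto simp: E_def)
    finally have z: "norm (w k + e k) \<le> E * (q + \<tau>)" by (simp add: distrib_left)
    \<comment> \<open>The coefficient \<open>u k\<close> is recovered from total mass:
      \<open>\<theta> k\<close> and \<open>t\<close> both sum to 1, so \<open>1 - u k\<close> is the
      sum of the entries of the small vector \<open>y\<close>.\<close>
    define y where "y = w k + e k"
    have y: "y = \<theta> k - u k *\<^sub>R t" by (simp add: y_def w_def \<eta>_def)
    have "1 - u k = (\<Sum>x\<in>UNIV. y $ x)" by (simp add: y sum_subtractf \<theta>1 t_sum flip: sum_distrib_left)
    then have "\<bar>u k - 1\<bar> \<le> (\<Sum>x\<in>UNIV. \<bar>y $ x\<bar>)" using sum_abs[of "\<lambda>x. y $ x" UNIV] by linarith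
    also have "\<dots> \<le> (\<Sum>x\<in>(UNIV::'d set). norm y)" by (intro sum_mono component_le_norm_cart)
    finally have u1: "\<bar>u k - 1\<bar> \<le> real CARD('d) * norm y" by simp
    have "\<theta> k - t = y + (u k - 1) *\<^sub>R t" by (simp add: y algebra_simps)
    then have "norm (\<theta> k - t) \<le> norm y + \<bar>u k - 1\<bar> * norm t"
      using norm_triangle_ineq[of y "(u k - 1) *\<^sub>R t"] by simp
    also have "\<dots> \<le> norm y + real CARD('d) * norm y * norm t"
      using u1 by (intro add_left_mono mult_right_mono) auto
    also have "\<dots> = norm y * (1 + real CARD('d) * norm t)" by (simp add: algebra_simps)
    also have "\<dots> \<le> E * (q + \<tau>) * (1 + real CARD('d) * norm t)"
      using z by (intro mult_right_mono) (auto simp: y_def)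
    also have "\<dots> = C * (q + \<tau>)" by (simp add: C_def)
    finally show "norm (\<theta> k - t) \<le> C * (((real J + n0) / (real k + n0)) powr b + \<tau>)"
      by (simp add: q_def)
  qed
qed

end

section \<open>Exponential martingale bounds\<close>

lemma exp_le_one_plus_plus_square:
  fixes x :: real
  assumes "\<bar>x\<bar> \<le> 1"
  shows "exp x \<le> 1 + x + x\<^sup>2"
proof (cases "0 \<le> x")
  case True
  then show ?thesis using assms exp_bound[of x] by simp
next
  case False
  \<comment> \<open>For negative \<open>x\<close> use
    \<open>(1 + x + x\<^sup>2) * (1 - x) = 1 - x^3 \<ge> 1\<close> together with
    \<open>1 - x \<le> exp (- x)\<close>.\<close>
  have "x * (x * x) \<le> 0" using False by (intro mult_nonpos_nonneg) auto
  then have "1 \<le> (1 + x + x\<^sup>2) * (1 - x)" by (simp add: algebra_simps power2_eq_square)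
  also have "\<dots> \<le> (1 + x + x\<^sup>2) * exp (- x)"
  proof (rule mult_left_mono)
    have "0 \<le> x * x" by simp
    then show "0 \<le> 1 + x + x\<^sup>2" using assms unfolding power2_eq_square by linarith
  qed (use exp_ge_add_one_self[of "- x"] in simp)
  finally show ?thesis by (simp add: exp_minus field_simps)
qed

context prob_space
begin

text \<open>The martingale property is stated in tested form, as orthogonality to bounded
  \<open>F i\<close>-measurable variables. Taking the exponential of the partial sum as test
  variable kills the linear term of \<open>exp (d n)\<close> and leaves the factor
  \<open>1 + (b n)\<^sup>2 \<le> exp ((b n)\<^sup>2)\<close>.\<close>

lemma expectation_exp_martingale_le:
  fixes d :: "nat \<Rightarrow> 'a \<Rightarrow> real" and F :: "nat \<Rightarrow> 'a measure"
  assumes adapted: "\<And>i j. i < j \<Longrightarrow> d i \<in> borel_measurable (F j)"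
    and meas: "\<And>i. d i \<in> borel_measurable M"
    and bound: "\<And>i \<omega>. \<omega> \<in> space M \<Longrightarrow> \<bar>d i \<omega>\<bar> \<le> b i" and b: "\<And>i. b i \<le> 1"
    and mart: "\<And>i Z B. Z \<in> borel_measurable (F i) \<Longrightarrow> (\<And>\<omega>. \<omega> \<in> space M \<Longrightarrow> \<bar>Z \<omega>\<bar> \<le> B) \<Longrightarrow>
        expectation (\<lambda>\<omega>. Z \<omega> * d i \<omega>) = 0"
  shows "expectation (\<lambda>\<omega>. exp (\<Sum>i<n. d i \<omega>)) \<le> exp (\<Sum>i<n. (b i)\<^sup>2)"
proof (induction n)
  case 0
  then show ?case by (simp add: prob_space)
next
  case (Suc n)
  define Z where "Z \<omega> = exp (\<Sum>i<n. d i \<omega>)" for \<omega>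
  have ZF: "Z \<in> borel_measurable (F n)"
    unfolding Z_def by (intro measurable_compose[OF _ borel_measurable_exp] borel_measurable_sum adapted) auto
  have [measurable]: "Z \<in> borel_measurable M" "d n \<in> borel_measurable M"
    unfolding Z_def using meas by auto
  have Zb: "Z \<omega> \<le> exp (\<Sum>i<n. b i)" if "\<omega> \<in> space M" for \<omega>
    unfolding Z_def using bound[OF that] by (auto intro!: sum_mono dest: abs_le_D1)
  have Z0: "0 \<le> Z \<omega>" for \<omega> by (simp add: Z_def)
  have d1: "\<bar>d n \<omega>\<bar> \<le> 1" if "\<omega> \<in> space M" for \<omega> using bound[OF that, of n] b[of n] by linarith
  have intZ: "integrable M Z"
    by (rule integrable_const_bound[where B = "exp (\<Sum>i<n. b i)"]) (auto simp: Z0 Zb)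
  have intZd: "integrable M (\<lambda>\<omega>. Z \<omega> * d n \<omega>)"
  proof (rule integrable_const_bound[where B = "exp (\<Sum>i<n. b i) * 1"])
    show "AE \<omega> in M. norm (Z \<omega> * d n \<omega>) \<le> exp (\<Sum>i<n. b i) * 1"
      by (rule AE_I2) (simp only: real_norm_def abs_mult, intro mult_mono, auto simp: Z0 Zb d1)
  qed auto
  have intE: "integrable M (\<lambda>\<omega>. exp (\<Sum>i<Suc n. d i \<omega>))"
  proof (rule integrable_const_bound[where B = "exp (\<Sum>i<Suc n. b i)"])
    show "AE \<omega> in M. norm (exp (\<Sum>i<Suc n. d i \<omega>)) \<le> exp (\<Sum>i<Suc n. b i)"
      using bound by (intro AE_I2) (auto simp del: sum.lessThan_Suc intro!: sum_mono dest: abs_le_D1)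
  qed (use meas in auto)
  have "expectation (\<lambda>\<omega>. exp (\<Sum>i<Suc n. d i \<omega>)) \<le> expectation (\<lambda>\<omega>. Z \<omega> * (1 + (b n)\<^sup>2) + Z \<omega> * d n \<omega>)"
  proof (rule integral_mono)
    fix \<omega> assume \<omega>: "\<omega> \<in> space M"
    have "exp (d n \<omega>) \<le> 1 + d n \<omega> + (d n \<omega>)\<^sup>2" by (rule exp_le_one_plus_plus_square[OF d1[OF \<omega>]])
    also have "(d n \<omega>)\<^sup>2 \<le> (b n)\<^sup>2" using power_mono[OF bound[OF \<omega>, of n], of 2] by simp
    finally have "Z \<omega> * exp (d n \<omega>) \<le> Z \<omega> * (1 + d n \<omega> + (b n)\<^sup>2)"
      using Z0 by (intro mult_left_mono) auto
    then show "exp (\<Sum>i<Suc n. d i \<omega>) \<le> Z \<omega> * (1 + (b n)\<^sup>2) + Z \<omega> * d n \<omega>"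
      by (simp add: Z_def exp_add algebra_simps)
  qed (use intE intZ intZd in auto)
  also have "\<dots> = expectation Z * (1 + (b n)\<^sup>2)"
    using intZ intZd mart[OF ZF, of "exp (\<Sum>i<n. b i)"] by (simp add: Z0 Zb)
  also have "\<dots> \<le> exp (\<Sum>i<n. (b i)\<^sup>2) * exp ((b n)\<^sup>2)"
    using Suc.IH exp_ge_add_one_self[of "(b n)\<^sup>2"] unfolding Z_def by (intro mult_mono) auto
  finally show ?case by (simp add: exp_add)
qed

text \<open>Chernoff bound; \<open>s\<close> may be negative, so that the same statement covers both
  tails.\<close>

lemma prob_martingale_ge:
  fixes d :: "nat \<Rightarrow> 'a \<Rightarrow> real" and F :: "nat \<Rightarrow> 'a measure"
  assumes adapted: "\<And>i j. i < j \<Longrightarrow> d i \<in> borel_measurable (F j)"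
    and meas: "\<And>i. d i \<in> borel_measurable M"
    and bound: "\<And>i \<omega>. \<omega> \<in> space M \<Longrightarrow> \<bar>d i \<omega>\<bar> \<le> b i" and b: "\<And>i. \<bar>s\<bar> * b i \<le> 1"
    and mart: "\<And>i Z B. Z \<in> borel_measurable (F i) \<Longrightarrow> (\<And>\<omega>. \<omega> \<in> space M \<Longrightarrow> \<bar>Z \<omega>\<bar> \<le> B) \<Longrightarrow>
        expectation (\<lambda>\<omega>. Z \<omega> * d i \<omega>) = 0"
  shows "prob {\<omega>\<in>space M. \<tau> \<le> s * (\<Sum>i<n. d i \<omega>)} \<le> exp (s\<^sup>2 * (\<Sum>i<n. (b i)\<^sup>2) - \<tau>)"
proof -
  have [measurable]: "d i \<in> borel_measurable M" for i by (rule meas)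
  have E: "expectation (\<lambda>\<omega>. exp (\<Sum>i<n. s * d i \<omega>)) \<le> exp (\<Sum>i<n. (\<bar>s\<bar> * b i)\<^sup>2)"
  proof (rule expectation_exp_martingale_le[where F = F])
    show "(\<lambda>\<omega>. s * d i \<omega>) \<in> borel_measurable (F j)" if "i < j" for i j
      using adapted[OF that] by auto
    show "\<bar>s * d i \<omega>\<bar> \<le> \<bar>s\<bar> * b i" if "\<omega> \<in> space M" for i \<omega>
      using bound[OF that] by (simp add: abs_mult mult_left_mono)
    show "expectation (\<lambda>\<omega>. Z \<omega> * (s * d i \<omega>)) = 0"
      if "Z \<in> borel_measurable (F i)" "\<And>\<omega>. \<omega> \<in> space M \<Longrightarrow> \<bar>Z \<omega>\<bar> \<le> B" for i Z B
      using mart[OF that] by (simp add: mult.left_commute[of _ s])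
  qed (use b in auto)
  have int: "integrable M (\<lambda>\<omega>. exp (s * (\<Sum>i<n. d i \<omega>)))"
  proof (rule integrable_const_bound[where B = "exp (\<Sum>i<n. \<bar>s\<bar> * b i)"])
    have "s * d i \<omega> \<le> \<bar>s\<bar> * b i" if "\<omega> \<in> space M" for i \<omega>
      using mult_left_mono[OF bound[OF that, of i], of "\<bar>s\<bar>"] abs_ge_self[of "s * d i \<omega>"]
      by (simp add: abs_mult)
    then show "AE \<omega> in M. norm (exp (s * (\<Sum>i<n. d i \<omega>))) \<le> exp (\<Sum>i<n. \<bar>s\<bar> * b i)"
      by (intro AE_I2) (auto simp: sum_distrib_left intro!: sum_mono)
  qed auto
  have "prob {\<omega>\<in>space M. exp \<tau> \<le> exp (s * (\<Sum>i<n. d i \<omega>))}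
    \<le> expectation (\<lambda>\<omega>. exp (s * (\<Sum>i<n. d i \<omega>))) / exp \<tau>"
    by (rule integral_Markov_inequality_measure[where A = "{}"]) (use int in auto)
  also have "\<dots> \<le> exp (\<Sum>i<n. (\<bar>s\<bar> * b i)\<^sup>2) / exp \<tau>"
    using E by (intro divide_right_mono) (auto simp: sum_distrib_left)
  finally show ?thesis by (simp add: exp_diff power_mult_distrib sum_distrib_left)
qed

lemma prob_abs_martingale_ge:
  fixes d :: "nat \<Rightarrow> 'a \<Rightarrow> real" and F :: "nat \<Rightarrow> 'a measure"
  assumes adapted: "\<And>i j. i < j \<Longrightarrow> d i \<in> borel_measurable (F j)"
    and meas: "\<And>i. d i \<in> borel_measurable M"
    and bound: "\<And>i \<omega>. \<omega> \<in> space M \<Longrightarrow> \<bar>d i \<omega>\<bar> \<le> b i"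
    and s: "0 \<le> s" and b: "\<And>i. s * b i \<le> 1"
    and mart: "\<And>i Z B. Z \<in> borel_measurable (F i) \<Longrightarrow> (\<And>\<omega>. \<omega> \<in> space M \<Longrightarrow> \<bar>Z \<omega>\<bar> \<le> B) \<Longrightarrow>
        expectation (\<lambda>\<omega>. Z \<omega> * d i \<omega>) = 0"
  shows "prob {\<omega>\<in>space M. \<tau> \<le> \<bar>\<Sum>i<n. d i \<omega>\<bar>} \<le> 2 * exp (s\<^sup>2 * (\<Sum>i<n. (b i)\<^sup>2) - s * \<tau>)"
proof -
  have [measurable]: "d i \<in> borel_measurable M" for i by (rule meas)
  let ?A = "\<lambda>s'. {\<omega>\<in>space M. s * \<tau> \<le> s' * (\<Sum>i<n. d i \<omega>)}"
  have "prob {\<omega>\<in>space M. \<tau> \<le> \<bar>\<Sum>i<n. d i \<omega>\<bar>} \<le> prob (?A s \<union> ?A (- s))"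
  proof (rule finite_measure_mono)
    show "{\<omega>\<in>space M. \<tau> \<le> \<bar>\<Sum>i<n. d i \<omega>\<bar>} \<subseteq> ?A s \<union> ?A (- s)"
    proof safe
      fix \<omega> assume *: "\<tau> \<le> \<bar>\<Sum>i<n. d i \<omega>\<bar>" "\<not> s * \<tau> \<le> - s * (\<Sum>i<n. d i \<omega>)"
      then have "s * \<tau> \<le> \<bar>s * (\<Sum>i<n. d i \<omega>)\<bar>" using s by (simp add: abs_mult mult_left_mono)
      then show "s * \<tau> \<le> s * (\<Sum>i<n. d i \<omega>)" using *(2) by (auto simp: abs_if split: if_splits)
    qed
  qed auto
  also have "\<dots> \<le> prob (?A s) + prob (?A (- s))" by (rule measure_Un_le) auto
  also have "\<dots> \<le> exp (s\<^sup>2 * (\<Sum>i<n. (b i)\<^sup>2) - s * \<tau>) + exp ((- s)\<^sup>2 * (\<Sum>i<n. (b i)\<^sup>2) - s * \<tau>)"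
    using s b by (intro add_mono prob_martingale_ge[where F = F and b = b, OF adapted meas bound _ mart]) auto
  finally show ?thesis by simp
qed

end

section \<open>The empirical measure of the particles\<close>

definition killed_matrix :: "('d::finite option \<Rightarrow> 'd option pmf) \<Rightarrow> real^'d^'d" where
  "killed_matrix P = (\<chi> x y. pmf (P (Some x)) (Some y))"

definition killing_vec :: "('d::finite option \<Rightarrow> 'd option pmf) \<Rightarrow> real^'d" where
  "killing_vec P = (\<chi> x. pmf (P (Some x)) None)"

lemma sum_pmf_Some:
  fixes p :: "'d::finite option pmf"
  shows "(\<Sum>y\<in>UNIV. pmf p (Some y)) = 1 - pmf p None"
proof -
  have "1 = (\<Sum>y\<in>UNIV. pmf p y)" by (simp add: sum_pmf_eq_1)
  also have "\<dots> = pmf p None + (\<Sum>y\<in>UNIV. pmf p (Some y))"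
    by (simp add: UNIV_option_conv sum.reindex)
  finally show ?thesis by simp
qed

lemma sum_K:
  assumes "(\<Sum>x\<in>UNIV. \<nu> $ x) = 1"
  shows "(\<Sum>y\<in>UNIV. K P \<nu> x y) = 1"
  by (simp add: K_def sum.distrib sum_pmf_Some assms flip: sum_distrib_left)

section \<open>Deterministic estimates for the step sizes\<close>

lemma step_size_Suc: "step_size g (Suc k) = g / (real k + (of_int \<lfloor>g\<rfloor> + 1))"
  by (simp add: step_size_def)

lemma step_size_bounds:
  assumes "0 < g"
  shows "0 \<le> step_size g (Suc k)" "step_size g (Suc k) \<le> 1"
proof -
  have "g \<le> real k + (of_int \<lfloor>g\<rfloor> + 1)" by linarith
  then show "0 \<le> step_size g (Suc k)" "step_size g (Suc k) \<le> 1"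
    using assms by (auto simp: step_size_Suc)
qed

text \<open>Abel summation in inductive form: removing the boundary term
  \<open>a j *\<^sub>R m j\<close> leaves a quantity of norm at most \<open>2 * a J - a j\<close>,
  and each step costs exactly the decrease of \<open>a\<close>.\<close>

lemma summation_by_parts_bound:
  fixes m :: "nat \<Rightarrow> 'a::real_normed_vector" and a :: "nat \<Rightarrow> real"
  assumes m: "\<And>i. norm (m i) \<le> 1" and a: "\<And>i. 0 \<le> a i" "\<And>i. a (Suc i) \<le> a i" and J: "J \<le> j"
  shows "norm (\<Sum>i=J..<j. a i *\<^sub>R (m (Suc i) - m i)) \<le> 2 * a J"
proof -
  define A where "A j = (\<Sum>i=J..<j. a i *\<^sub>R (m (Suc i) - m i))" for j
  have am: "norm (b *\<^sub>R m i) \<le> b" if "0 \<le> b" for b i using m[of i] that by (simp add: mult_left_le)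
  have "norm (A j - a j *\<^sub>R m j) \<le> 2 * a J - a j"
    using J
  proof (induction j rule: dec_induct)
    case base
    then show ?case using am[OF a(1)[of J], of J] by (simp add: A_def)
  next
    case (step j)
    have "A (Suc j) - a (Suc j) *\<^sub>R m (Suc j) = (A j - a j *\<^sub>R m j) + (a j - a (Suc j)) *\<^sub>R m (Suc j)"
      using step.hyps by (simp add: A_def algebra_simps)
    also have "norm \<dots> \<le> norm (A j - a j *\<^sub>R m j) + norm ((a j - a (Suc j)) *\<^sub>R m (Suc j))"
      by (rule norm_triangle_ineq)
    also have "\<dots> \<le> (2 * a J - a j) + (a j - a (Suc j))"
      using am[of "a j - a (Suc j)" "Suc j"] a(2)[of j] by (intro add_mono step.IH) simp
    finally show ?case by simp
  qed
  then have "norm (A j) \<le> 2 * a J"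
    using am[OF a(1)[of j], of j] norm_triangle_ineq[of "A j - a j *\<^sub>R m j" "a j *\<^sub>R m j"] by simp
  then show ?thesis by (simp add: A_def)
qed

lemma sum_inverse_squares_le:
  assumes "1 \<le> J"
  shows "(\<Sum>i<n. 1 / (real (J + i) + 1)\<^sup>2) \<le> 1 / real J - 1 / real (J + n)"
proof (induction n)
  case 0
  then show ?case by simp
next
  case (Suc n)
  define y where "y = real (J + n)"
  have y: "y > 0" using assms by (simp add: y_def)
  have "1 / (y + 1)\<^sup>2 \<le> 1 / (y * (y + 1))"
    using y by (intro divide_left_mono) (auto simp: power2_eq_square)
  also have "\<dots> = 1 / y - 1 / (y + 1)" using y by (simp add: field_simps)
  finally show ?case using Suc by (simp add: y_def add_ac)
qed

section \<open>One run of the algorithm: filtration, conditional law and martingale noise\<close>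

locale algorithm_run = prob_space M for M :: "'w measure" +
  fixes P :: "'d::finite option \<Rightarrow> 'd option pmf" and g :: real and x\<^sub>0 :: 'd and N :: nat
    and X :: "nat \<Rightarrow> nat \<Rightarrow> 'w \<Rightarrow> 'd" and \<theta> :: "nat \<Rightarrow> 'w \<Rightarrow> real^'d" and F :: "nat \<Rightarrow> 'w measure"
  assumes g: "0 < g" and N: "1 \<le> N" and alg: "algorithm_I M P g x\<^sub>0 N X \<theta> F"
begin

lemma X_measurable [measurable]: "i \<in> {1..N} \<Longrightarrow> X i k \<in> M \<rightarrow>\<^sub>M count_space UNIV"
  and X_0: "i \<in> {1..N} \<Longrightarrow> \<omega> \<in> space M \<Longrightarrow> X i 0 \<omega> = x\<^sub>0"
  and \<theta>_0: "\<omega> \<in> space M \<Longrightarrow> \<theta> 0 \<omega> = axis x\<^sub>0 1"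
  and F_0: "F 0 = sigma (space M) {}"
  and cond: "AE \<omega> in M. (\<forall>i\<in>{1..N}. X i k \<omega> = x i) \<longrightarrow>
        real_cond_exp M (F k) (indicator {\<omega>\<in>space M. \<forall>i\<in>{1..N}. X i (Suc k) \<omega> = y i}) \<omega>
          = (\<Prod>i\<in>{1..N}. K P (\<theta> k \<omega>) (x i) (y i))"
  and F_Suc: "F (Suc k) = sigma (space M)
        (sets (F k) \<union> {X i (Suc k) -` A \<inter> space M | i A. i \<in> {1..N}})"
  and \<theta>_Suc: "\<omega> \<in> space M \<Longrightarrow> \<theta> (Suc k) \<omega> =
        (1 - step_size g (Suc k)) *\<^sub>R \<theta> k \<omega> +
        step_size g (Suc k) *\<^sub>R ((1 / real N) *\<^sub>R (\<Sum>i\<in>{1..N}. axis (X i (Suc k) \<omega>) 1))"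
  using alg unfolding algorithm_I_def by blast+

definition emp :: "nat \<Rightarrow> 'w \<Rightarrow> real^'d" where
  "emp k \<omega> = (1 / real N) *\<^sub>R (\<Sum>i\<in>{1..N}. axis (X i k \<omega>) 1)"

text \<open>The subtracted vector is the conditional mean of \<open>emp (Suc k)\<close> given
  \<open>F k\<close>: the average over the particles of the rows of
  \<open>K P (\<theta> k \<omega>)\<close> at their current positions.\<close>

definition noise :: "nat \<Rightarrow> 'w \<Rightarrow> real^'d" where
  "noise k \<omega> = emp (Suc k) \<omega> - (emp k \<omega> v* killed_matrix P + (emp k \<omega> \<bullet> killing_vec P) *\<^sub>R \<theta> k \<omega>)"

lemma space_F [simp]: "space (F k) = space M"
  by (cases k) (simp_all add: F_0 F_Suc space_measure_of_conv)

lemma sets_F_Suc: "sets (F (Suc k)) = sigma_sets (space M)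
   (sets (F k) \<union> {X i (Suc k) -` A \<inter> space M | i A. i \<in> {1..N}})"
proof -
  have "sets (F k) \<union> {X i (Suc k) -` A \<inter> space M | i A. i \<in> {1..N}} \<subseteq> Pow (space M)"
    using sets.sets_into_space[of _ "F k"] by auto
  then show ?thesis by (simp add: F_Suc)
qed

lemma subalgebra_F: "subalgebra M (F k)"
proof (induction k)
  case 0
  show ?case by (simp add: F_0 subalgebra_def sigma_sets_empty_eq)
next
  case (Suc k)
  have "sets (F k) \<union> {X i (Suc k) -` A \<inter> space M | i A. i \<in> {1..N}} \<subseteq> sets M"
    using Suc by (auto simp: subalgebra_def intro!: measurable_sets[OF X_measurable])
  then show ?case unfolding subalgebra_def sets_F_Suc by (simp add: sets.sigma_sets_subset)
qed

lemma F_mono: "j \<le> k \<Longrightarrow> subalgebra (F k) (F j)"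
proof (induction k rule: dec_induct)
  case (step k)
  then show ?case by (auto simp: subalgebra_def sets_F_Suc)
qed (simp add: subalgebra_def)

lemma X_measurable_F: "i \<in> {1..N} \<Longrightarrow> X i k \<in> F k \<rightarrow>\<^sub>M count_space UNIV"
proof (cases k)
  case 0
  assume i: "i \<in> {1..N}"
  have "(\<lambda>_. x\<^sub>0) \<in> F k \<rightarrow>\<^sub>M count_space UNIV" by simp
  then show ?thesis by (rule measurable_cong[THEN iffD1, rotated]) (simp add: 0 X_0[OF i])
next
  case (Suc k')
  assume "i \<in> {1..N}"
  then show ?thesis unfolding Suc by (intro measurableI) (auto simp: sets_F_Suc)
qed

lemma emp_nonneg: "0 \<le> emp k \<omega> $ x"
  by (auto simp: emp_def axis_def intro!: divide_nonneg_nonneg sum_nonneg)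

lemma emp_inner: "emp k \<omega> \<bullet> v = (1 / real N) * (\<Sum>i\<in>{1..N}. v $ X i k \<omega>)"
  by (simp add: emp_def inner_sum_left inner_axis')

lemma emp_sum: "(\<Sum>x\<in>UNIV. emp k \<omega> $ x) = 1"
  using emp_inner[of k \<omega> "\<chi> x. 1"] N by (simp add: inner_vec_def)

lemma emp_measurable: "(\<lambda>\<omega>. emp k \<omega> $ x) \<in> borel_measurable (F k)"
proof -
  have "(\<lambda>\<omega>. axis (X i k \<omega>) (1::real) $ x) \<in> borel_measurable (F k)" if "i \<in> {1..N}" for i
    by (rule measurable_compose[OF X_measurable_F[OF that]]) simp
  then show ?thesis by (simp add: emp_def)
qed

lemma \<theta>_step: "\<omega> \<in> space M \<Longrightarrow>
    \<theta> (Suc k) \<omega> = (1 - step_size g (Suc k)) *\<^sub>R \<theta> k \<omega> + step_size g (Suc k) *\<^sub>R emp (Suc k) \<omega>"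
  by (simp add: \<theta>_Suc emp_def)

lemma \<theta>_nonneg: "\<omega> \<in> space M \<Longrightarrow> 0 \<le> \<theta> k \<omega> $ x"
proof (induction k)
  case (Suc k)
  then show ?case using step_size_bounds[OF g, of k] by (simp add: \<theta>_step emp_nonneg)
qed (simp add: \<theta>_0 axis_def)

lemma \<theta>_sum: "\<omega> \<in> space M \<Longrightarrow> (\<Sum>x\<in>UNIV. \<theta> k \<omega> $ x) = 1"
proof (induction k)
  case (Suc k)
  then show ?case by (simp add: \<theta>_step sum.distrib emp_sum flip: sum_distrib_left)
qed (simp add: \<theta>_0 axis_def)

lemma \<theta>_measurable: "(\<lambda>\<omega>. \<theta> k \<omega> $ x) \<in> borel_measurable (F k)"
proof (induction k)
  case 0
  have "(\<lambda>_. axis x\<^sub>0 1 $ x) \<in> borel_measurable (F 0)" by simp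
  then show ?case by (rule measurable_cong[THEN iffD1, rotated]) (simp add: \<theta>_0)
next
  case (Suc k)
  have [measurable]: "(\<lambda>\<omega>. \<theta> k \<omega> $ x) \<in> borel_measurable (F (Suc k))"
    using measurable_from_subalg[OF F_mono Suc, of "Suc k"] by simp
  have [measurable]: "(\<lambda>\<omega>. emp (Suc k) \<omega> $ x) \<in> borel_measurable (F (Suc k))"
    by (rule emp_measurable)
  have "(\<lambda>\<omega>. (1 - step_size g (Suc k)) * \<theta> k \<omega> $ x + step_size g (Suc k) * emp (Suc k) \<omega> $ x)
    \<in> borel_measurable (F (Suc k))" by measurable
  then show ?case by (rule measurable_cong[THEN iffD1, rotated]) (simp add: \<theta>_step)
qed

lemma K_measurable: "i \<in> {1..N} \<Longrightarrow> (\<lambda>\<omega>. K P (\<theta> k \<omega>) (X i k \<omega>) y) \<in> borel_measurable (F k)"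
  unfolding K_def
  by (intro borel_measurable_add borel_measurable_times \<theta>_measurable
      measurable_compose[OF X_measurable_F[of i k]]) auto

text \<open>The algorithm prescribes the joint law of all particles; this extracts the marginal of
  one particle, tested against bounded \<open>F k\<close>-measurable variables. Summing the product
  law over the other particles gives factors 1.\<close>

lemma expectation_particle:
  assumes i: "i \<in> {1..N}" and Z: "Z \<in> borel_measurable (F k)"
    and Zb: "\<And>\<omega>. \<omega> \<in> space M \<Longrightarrow> \<bar>Z \<omega>\<bar> \<le> B"
  shows "integrable M (\<lambda>\<omega>. Z \<omega> * K P (\<theta> k \<omega>) (X i k \<omega>) z)"
    and "expectation (\<lambda>\<omega>. Z \<omega> * of_bool (X i (Suc k) \<omega> = z)) = expectation (\<lambda>\<omega>. Z \<omega> * K P (\<theta> k \<omega>) (X i k \<omega>) z)"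
proof -
  interpret finite_measure_subalgebra M "F k"
    by unfold_locales (rule subalgebra_F)
  note [measurable] = measurable_from_subalg[OF subalgebra_F Z] Z
    measurable_from_subalg[OF subalgebra_F K_measurable]
  \<comment> \<open>\<open>Y\<close> lists the joint configurations with particle \<open>i\<close>
    at \<open>z\<close>. The events \<open>A y\<close> for \<open>y\<close> in \<open>Y\<close> are
    disjoint and exhaust the event that particle \<open>i\<close> moves to \<open>z\<close>.\<close>
  define Y where "Y = PiE {1..N} (\<lambda>j. if j = i then {z} else UNIV)"
  have finY: "finite Y" unfolding Y_def by (intro finite_PiE) auto
  define A where "A y = {\<omega>\<in>space M. \<forall>j\<in>{1..N}. X j (Suc k) \<omega> = y j}" for y
  have A [measurable]: "A y \<in> sets M" for y unfolding A_def by measurable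
  have ind: "of_bool (X i (Suc k) \<omega> = z) = (\<Sum>y\<in>Y. indicator (A y) \<omega> :: real)" if \<omega>: "\<omega> \<in> space M" for \<omega>
  proof -
    define y' where "y' = restrict (\<lambda>j. X j (Suc k) \<omega>) {1..N}"
    have "indicator (A y) \<omega> = (if y = y' then 1 else 0 :: real)" if "y \<in> Y" for y
    proof -
      have "y \<in> extensional {1..N}" using that by (auto simp: Y_def PiE_def)
      then have "\<omega> \<in> A y \<longleftrightarrow> y = y'"
        using \<omega> by (auto simp: A_def y'_def extensional_def fun_eq_iff)
      then show ?thesis by (simp add: indicator_def)
    qed
    then have "(\<Sum>y\<in>Y. indicator (A y) \<omega> :: real) = (\<Sum>y\<in>Y. if y = y' then 1 else 0)" by (rule sum.cong[OF refl])
    also have "\<dots> = of_bool (y' \<in> Y)" using finY by simp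
    also have "y' \<in> Y \<longleftrightarrow> X i (Suc k) \<omega> = z" using i by (auto simp: Y_def y'_def PiE_def Pi_def)
    finally show ?thesis by simp
  qed
  define R where "R y \<omega> = (\<Prod>j\<in>{1..N}. K P (\<theta> k \<omega>) (X j k \<omega>) (y j))" for y \<omega>
  have R [measurable]: "R y \<in> borel_measurable M" for y
    unfolding R_def by measurable
  have ce: "AE \<omega> in M. real_cond_exp M (F k) (indicator (A y)) \<omega> = R y \<omega>" for y
  proof -
    \<comment> \<open>The exceptional null set depends on the current configuration
      \<open>x\<close>. There are finitely many, so one null set serves all of them, and
      \<open>x\<close> can be set to the random positions.\<close>
    have "AE \<omega> in M. \<forall>x\<in>PiE {1..N} (\<lambda>_. UNIV). (\<forall>i\<in>{1..N}. X i k \<omega> = x i) \<longrightarrow>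
        real_cond_exp M (F k) (indicator (A y)) \<omega> = (\<Prod>i\<in>{1..N}. K P (\<theta> k \<omega>) (x i) (y i))"
      using cond[of k _ y] by (intro AE_finite_allI) (auto simp: A_def intro!: finite_PiE)
    then show ?thesis
    proof (rule AE_mp, intro AE_I2 impI)
      fix \<omega> assume "\<forall>x\<in>PiE {1..N} (\<lambda>_. UNIV). (\<forall>i\<in>{1..N}. X i k \<omega> = x i) \<longrightarrow>
        real_cond_exp M (F k) (indicator (A y)) \<omega> = (\<Prod>i\<in>{1..N}. K P (\<theta> k \<omega>) (x i) (y i))"
      from bspec[OF this, of "restrict (\<lambda>j. X j k \<omega>) {1..N}"]
      show "real_cond_exp M (F k) (indicator (A y)) \<omega> = R y \<omega>" by (simp add: R_def)
    qed
  qed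
  have intA: "integrable M (\<lambda>\<omega>. Z \<omega> * indicator (A y) \<omega>)" for y
  proof (rule integrable_const_bound[where B = B])
    show "AE \<omega> in M. norm (Z \<omega> * indicator (A y) \<omega>) \<le> B"
      using Zb by (intro AE_I2) (auto simp: indicator_def split: if_splits intro: order_trans[OF abs_ge_zero])
  qed measurable
  have ZR: "integrable M (\<lambda>\<omega>. Z \<omega> * R y \<omega>)"
    "expectation (\<lambda>\<omega>. Z \<omega> * R y \<omega>) = expectation (\<lambda>\<omega>. Z \<omega> * indicator (A y) \<omega>)" for y
  proof -
    note I = real_cond_exp_intg[OF intA[of y] Z borel_measurable_indicator[OF A]]
    have eq: "AE \<omega> in M. Z \<omega> * real_cond_exp M (F k) (indicator (A y)) \<omega> = Z \<omega> * R y \<omega>"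
      using ce[of y] by auto
    show "integrable M (\<lambda>\<omega>. Z \<omega> * R y \<omega>)"
      by (rule integrable_cong_AE_imp[OF I(1) _ eq]) measurable
    show "expectation (\<lambda>\<omega>. Z \<omega> * R y \<omega>) = expectation (\<lambda>\<omega>. Z \<omega> * indicator (A y) \<omega>)"
      unfolding I(2)[symmetric] using eq by (intro integral_cong_AE) auto
  qed
  have Ksum: "K P (\<theta> k \<omega>) (X i k \<omega>) z = (\<Sum>y\<in>Y. R y \<omega>)" if \<omega>: "\<omega> \<in> space M" for \<omega>
  proof -
    \<comment> \<open>Exchange of sum and product: the coordinates other than \<open>i\<close> range
      freely and contribute row sums of \<open>K\<close>, each equal to 1.\<close>
    have "(\<Sum>y\<in>Y. R y \<omega>) = (\<Prod>j\<in>{1..N}. \<Sum>z'\<in>(if j = i then {z} else UNIV). K P (\<theta> k \<omega>) (X j k \<omega>) z')"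
      unfolding R_def Y_def by (rule prod_sum_PiE[symmetric]) auto
    also have "\<dots> = (\<Prod>j\<in>{1..N}. if j = i then K P (\<theta> k \<omega>) (X i k \<omega>) z else 1)"
      by (intro prod.cong refl) (simp add: sum_K[OF \<theta>_sum[OF \<omega>]])
    also have "\<dots> = K P (\<theta> k \<omega>) (X i k \<omega>) z" using i by simp
    finally show ?thesis by simp
  qed
  have "integrable M (\<lambda>\<omega>. \<Sum>y\<in>Y. Z \<omega> * R y \<omega>)" using ZR(1) by auto
  then show "integrable M (\<lambda>\<omega>. Z \<omega> * K P (\<theta> k \<omega>) (X i k \<omega>) z)"
    by (rule Bochner_Integration.integrable_cong[THEN iffD1, rotated 2]) (simp_all add: Ksum sum_distrib_left)
  have "expectation (\<lambda>\<omega>. Z \<omega> * of_bool (X i (Suc k) \<omega> = z)) = expectation (\<lambda>\<omega>. \<Sum>y\<in>Y. Z \<omega> * indicator (A y) \<omega>)"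
    by (intro Bochner_Integration.integral_cong refl) (simp add: ind sum_distrib_left)
  also have "\<dots> = (\<Sum>y\<in>Y. expectation (\<lambda>\<omega>. Z \<omega> * R y \<omega>))"
    using intA by (simp add: ZR(2))
  also have "\<dots> = expectation (\<lambda>\<omega>. \<Sum>y\<in>Y. Z \<omega> * R y \<omega>)"
    using ZR(1) by simp
  also have "\<dots> = expectation (\<lambda>\<omega>. Z \<omega> * K P (\<theta> k \<omega>) (X i k \<omega>) z)"
    by (intro Bochner_Integration.integral_cong refl) (simp add: Ksum sum_distrib_left)
  finally show "expectation (\<lambda>\<omega>. Z \<omega> * of_bool (X i (Suc k) \<omega> = z)) = expectation (\<lambda>\<omega>. Z \<omega> * K P (\<theta> k \<omega>) (X i k \<omega>) z)" .
qed

lemma noise_component: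
  "noise k \<omega> $ z = (1 / real N) * (\<Sum>i\<in>{1..N}. of_bool (X i (Suc k) \<omega> = z) - K P (\<theta> k \<omega>) (X i k \<omega>) z)"
proof -
  have "(emp k \<omega> v* killed_matrix P) $ z = emp k \<omega> \<bullet> (\<chi> x. pmf (P (Some x)) (Some z))"
    by (simp add: vector_matrix_mult_def inner_vec_def killed_matrix_def)
  also have "\<dots> + (emp k \<omega> \<bullet> killing_vec P) * \<theta> k \<omega> $ z = (1 / real N) * (\<Sum>i\<in>{1..N}. K P (\<theta> k \<omega>) (X i k \<omega>) z)"
    by (simp add: emp_inner K_def killing_vec_def sum.distrib sum_distrib_right add_divide_distrib)
  finally have "noise k \<omega> $ z = emp (Suc k) \<omega> $ z - (1 / real N) * (\<Sum>i\<in>{1..N}. K P (\<theta> k \<omega>) (X i k \<omega>) z)"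
    by (simp add: noise_def)
  moreover have "emp (Suc k) \<omega> $ z = (1 / real N) * (\<Sum>i\<in>{1..N}. of_bool (X i (Suc k) \<omega> = z))"
  proof -
    have "axis x (1::real) $ z = of_bool (x = z)" for x by (simp add: axis_def)
    then show ?thesis by (simp add: emp_def)
  qed
  ultimately show ?thesis by (simp only: sum_subtractf right_diff_distrib)
qed

lemma noise_measurable: "(\<lambda>\<omega>. noise k \<omega> $ z) \<in> borel_measurable (F (Suc k))"
proof -
  have [measurable]: "(\<lambda>\<omega>. K P (\<theta> k \<omega>) (X i k \<omega>) z) \<in> borel_measurable (F (Suc k))"
    "X i (Suc k) \<in> F (Suc k) \<rightarrow>\<^sub>M count_space UNIV"
    if "i \<in> {1..N}" for i
    using that measurable_from_subalg[OF F_mono K_measurable, of k "Suc k"] X_measurable_F by auto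
  show ?thesis unfolding noise_component by measurable
qed

lemma noise_bounded:
  assumes \<omega>: "\<omega> \<in> space M"
  shows "\<bar>noise k \<omega> $ z\<bar> \<le> 1"
proof -
  have K: "0 \<le> K P (\<theta> k \<omega>) x y" for x y by (simp add: K_def \<theta>_nonneg \<omega>)
  have "K P (\<theta> k \<omega>) x z \<le> 1" for x
    using member_le_sum[of z UNIV "K P (\<theta> k \<omega>) x"] K sum_K[OF \<theta>_sum[OF \<omega>]] by simp
  then have "\<bar>of_bool (X i (Suc k) \<omega> = z) - K P (\<theta> k \<omega>) (X i k \<omega>) z\<bar> \<le> 1" for i
    using K[of "X i k \<omega>" z] by (cases "X i (Suc k) \<omega> = z") auto
  then have "\<bar>\<Sum>i\<in>{1..N}. of_bool (X i (Suc k) \<omega> = z) - K P (\<theta> k \<omega>) (X i k \<omega>) z\<bar> \<le> (\<Sum>i\<in>{1..N}. 1)"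
    by (intro order_trans[OF sum_abs] sum_mono)
  then show ?thesis using N unfolding noise_component by (simp add: abs_mult)
qed

text \<open>The tested martingale property in the form that \<open>prob_abs_martingale_ge\<close>
  requires.\<close>

lemma noise_martingale:
  assumes Z: "Z \<in> borel_measurable (F k)" and Zb: "\<And>\<omega>. \<omega> \<in> space M \<Longrightarrow> \<bar>Z \<omega>\<bar> \<le> B"
  shows "expectation (\<lambda>\<omega>. Z \<omega> * noise k \<omega> $ z) = 0"
proof -
  note [measurable] = measurable_from_subalg[OF subalgebra_F Z]
  have int: "integrable M (\<lambda>\<omega>. Z \<omega> * of_bool (X i (Suc k) \<omega> = z))" if i: "i \<in> {1..N}" for i
  proof -
    note [measurable] = X_measurable[OF i, of "Suc k"]
    show ?thesis
    proof (rule integrable_const_bound[where B = B])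
      show "AE \<omega> in M. norm (Z \<omega> * of_bool (X i (Suc k) \<omega> = z)) \<le> B"
        using Zb by (intro AE_I2) (auto intro: order_trans[OF abs_ge_zero])
    qed measurable
  qed
  have eq: "(\<lambda>\<omega>. Z \<omega> * noise k \<omega> $ z) = (\<lambda>\<omega>. (1 / real N) *
      (\<Sum>i\<in>{1..N}. Z \<omega> * of_bool (X i (Suc k) \<omega> = z) - Z \<omega> * K P (\<theta> k \<omega>) (X i k \<omega>) z))"
    unfolding noise_component by (simp only: mult.left_commute[of "Z _"] sum_distrib_left right_diff_distrib)
  have "expectation (\<lambda>\<omega>. Z \<omega> * noise k \<omega> $ z) = (1 / real N) *
      expectation (\<lambda>\<omega>. \<Sum>i\<in>{1..N}. Z \<omega> * of_bool (X i (Suc k) \<omega> = z) - Z \<omega> * K P (\<theta> k \<omega>) (X i k \<omega>) z)"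
    unfolding eq by (rule Bochner_Integration.integral_mult_right_zero)
  also have "expectation (\<lambda>\<omega>. \<Sum>i\<in>{1..N}. Z \<omega> * of_bool (X i (Suc k) \<omega> = z) - Z \<omega> * K P (\<theta> k \<omega>) (X i k \<omega>) z)
    = (\<Sum>i\<in>{1..N}. expectation (\<lambda>\<omega>. Z \<omega> * of_bool (X i (Suc k) \<omega> = z) - Z \<omega> * K P (\<theta> k \<omega>) (X i k \<omega>) z))"
    using int expectation_particle(1)[OF _ Z Zb]
    by (intro Bochner_Integration.integral_sum Bochner_Integration.integrable_diff) auto
  also have "\<dots> = (\<Sum>i\<in>{1..N}. 0)"
    using int expectation_particle[OF _ Z Zb]
    by (intro sum.cong refl) (subst Bochner_Integration.integral_diff, auto)
  finally show ?thesis by simp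
qed

section \<open>Concentration of the accumulated noise\<close>

definition cumulative_noise :: "nat \<Rightarrow> 'w \<Rightarrow> real^'d" where
  "cumulative_noise k \<omega> = (\<Sum>i<k. step_size g (Suc i) *\<^sub>R noise i \<omega>)"

lemma cumulative_noise_diff:
  "cumulative_noise (J + n) \<omega> - cumulative_noise J \<omega> = (\<Sum>i<n. step_size g (Suc (J + i)) *\<^sub>R noise (J + i) \<omega>)"
  by (induction n) (simp_all add: cumulative_noise_def algebra_simps)

lemma cumulative_noise_measurable [measurable]:
  "(\<lambda>\<omega>. cumulative_noise k \<omega> $ x) \<in> borel_measurable M"
  using measurable_from_subalg[OF subalgebra_F noise_measurable]
  unfolding cumulative_noise_def by simp

text \<open>The squared step sizes after \<open>J\<close> sum to at most
  \<open>g\<^sup>2 / J\<close>, so deviations of size \<open>J powr (-1/4)\<close> exceed the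
  typical scale \<open>J powr (-1/2)\<close>. The bound depends neither on \<open>j\<close> nor on
  the number of particles.\<close>

lemma prob_cumulative_noise_ge:
  assumes J: "1 \<le> J" "g\<^sup>2 \<le> real J" and "J \<le> j"
  shows "prob {\<omega>\<in>space M. real J powr (-1/4) \<le> \<bar>(cumulative_noise j \<omega> - cumulative_noise J \<omega>) $ x\<bar>}
    \<le> 2 * exp (g\<^sup>2 - real J powr (1/4))"
proof -
  obtain n where n: "j = J + n" using \<open>J \<le> j\<close> le_Suc_ex by blast
  define d where "d i \<omega> = step_size g (Suc (J + i)) * noise (J + i) \<omega> $ x" for i \<omega>
  define b where "b i = step_size g (Suc (J + i))" for i
  \<comment> \<open>With this exponent the variance term is at most \<open>g\<^sup>2\<close>, the
    gain is \<open>s * J powr (-1/4) = J powr (1/4)\<close>, and \<open>g \<le> s\<close> yields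
    \<open>s * b i \<le> 1\<close>.\<close>
  define s where "s = sqrt (real J)"
  have s: "0 < s" "s\<^sup>2 = real J" "s * s = real J" "g \<le> s"
    using J g real_le_rsqrt by (auto simp: s_def)
  have b0: "0 \<le> b i" for i using step_size_bounds[OF g] by (simp add: b_def)
  have b1: "b i \<le> g / (real (J + i) + 1)" for i
    unfolding b_def step_size_Suc using g by (intro frac_le) auto
  have "prob {\<omega>\<in>space M. real J powr (-1/4) \<le> \<bar>\<Sum>i<n. d i \<omega>\<bar>}
    \<le> 2 * exp (s\<^sup>2 * (\<Sum>i<n. (b i)\<^sup>2) - s * real J powr (-1/4))"
  proof (rule prob_abs_martingale_ge[where F = "\<lambda>i. F (J + i)"])
    show "d i \<in> borel_measurable (F (J + j))" if "i < j" for i j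
      unfolding d_def using that
      by (intro borel_measurable_times borel_measurable_const measurable_from_subalg[OF F_mono noise_measurable]) auto
    show "d i \<in> borel_measurable M" for i
      unfolding d_def using measurable_from_subalg[OF subalgebra_F noise_measurable] by simp
    show "\<bar>d i \<omega>\<bar> \<le> b i" if "\<omega> \<in> space M" for i \<omega>
      using noise_bounded[OF that, of "J + i" x] b0[of i] by (simp add: d_def abs_mult mult_left_le flip: b_def)
    show "s * b i \<le> 1" for i
    proof -
      have "s * b i \<le> s * (g / (real (J + i) + 1))" using s b1 by (intro mult_left_mono) auto
      also have "s * g \<le> real (J + i) + 1" using mult_left_mono[OF s(4), of s] s by simp
      then have "s * (g / (real (J + i) + 1)) \<le> 1" by (simp add: field_simps)
      finally show ?thesis .
    qed
    show "expectation (\<lambda>\<omega>. Z \<omega> * d i \<omega>) = 0"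
      if "Z \<in> borel_measurable (F (J + i))" "\<And>\<omega>. \<omega> \<in> space M \<Longrightarrow> \<bar>Z \<omega>\<bar> \<le> B" for i Z B
      using noise_martingale[OF that, of x] by (simp add: d_def mult.left_commute[of "Z _"])
  qed (use s in auto)
  also have "\<dots> \<le> 2 * exp (g\<^sup>2 - real J powr (1/4))"
  proof -
    have "(\<Sum>i<n. (b i)\<^sup>2) \<le> (\<Sum>i<n. g\<^sup>2 * (1 / (real (J + i) + 1)\<^sup>2))"
      using power_mono[OF b1 b0, of _ 2] by (intro sum_mono) (simp add: power_divide)
    also have "\<dots> \<le> g\<^sup>2 * (1 / real J - 1 / real (J + n))"
      using sum_inverse_squares_le[OF J(1), of n] by (simp only: sum_distrib_left[symmetric] mult_left_mono zero_le_power2)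
    also have "\<dots> \<le> g\<^sup>2 * (1 / real J)" by (intro mult_left_mono) auto
    finally have "s\<^sup>2 * (\<Sum>i<n. (b i)\<^sup>2) \<le> s\<^sup>2 * (g\<^sup>2 * (1 / real J))" by (intro mult_left_mono) auto
    also have "\<dots> = g\<^sup>2" using J s(2) by simp
    moreover have "s * real J powr (-1/4) = real J powr (1/4)"
      using J unfolding s_def by (simp add: powr_half_sqrt[symmetric] flip: powr_add)
    ultimately show ?thesis by simp
  qed
  finally show ?thesis by (simp add: n cumulative_noise_diff d_def)
qed

end

section \<open>Quasi-stationary distribution and rate of convergence\<close>

text \<open>A closed \<open>S\<close>, enlarged by the absorbing state, contains everything
  reachable from a point of \<open>S\<close>: absorption excludes a return through
  \<open>None\<close>. Irreducibility makes every transient state reachable.\<close>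

lemma irreducible_closed_set:
  fixes P :: "'d::finite option \<Rightarrow> 'd option pmf"
  assumes absorbing: "pmf (P None) None = 1" and irreducible: "irreducible_class P (range Some)"
    and S: "S \<noteq> {}" and closed: "\<And>x y. x \<in> S \<Longrightarrow> killed_matrix P $ x $ y > 0 \<Longrightarrow> y \<in> S"
  shows "S = UNIV"
proof -
  obtain x where x: "x \<in> S" using S by blast
  have "(\<Sum>y\<in>UNIV. pmf (P None) (Some y)) = 0" by (simp add: sum_pmf_Some absorbing)
  then have "pmf (P None) (Some y) = 0" for y by (subst (asm) sum_nonneg_eq_0_iff) auto
  then have None: "set_pmf (P None) \<subseteq> {None}"
    by (auto simp: set_pmf_iff) (metis not_Some_eq)
  have "set_pmf (chain_law P (return_pmf (Some x)) n) \<subseteq> insert None (Some ` S)" for n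
  proof (induction n)
    case (Suc n)
    have "z \<in> insert None (Some ` S)" if z: "z \<in> set_pmf (P y)" and y: "y \<in> insert None (Some ` S)" for y z
    proof (cases y)
      case (Some y')
      then show ?thesis using closed[of y'] z y
        by (cases z) (auto simp: killed_matrix_def pmf_positive)
    qed (use None z in auto)
    then show ?case using Suc by (auto simp: set_bind_pmf) blast
  qed (simp add: x)
  moreover have "Some y \<in> set_pmf (chain_law P (return_pmf (Some x)) n)"
    if "0 < pmf (chain_law P (return_pmf (Some x)) n) (Some y)" for n y
    using that by (simp add: set_pmf_iff)
  ultimately show ?thesis using irreducible unfolding irreducible_class_def by blast
qed

text \<open>For \<open>n = 1\<close> quasi-stationarity says that \<open>\<mu>\<close> is
  proportional to its image under the killed matrix; the eigenvalue \<open>l\<close> is the one-step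
  survival probability.\<close>

lemma quasi_stationary_left_eigenvector:
  fixes P :: "'d::finite option \<Rightarrow> 'd option pmf"
  assumes absorbing: "pmf (P None) None = 1" and irreducible: "irreducible_class P (range Some)"
    and killing: "\<exists>x. pmf (P (Some x)) None > 0" and qsd: "quasi_stationary P \<mu>"
  obtains l where "0 < l" "l < 1" "prob_vec \<mu> v* killed_matrix P = l *\<^sub>R prob_vec \<mu>"
    "\<And>x. prob_vec \<mu> $ x > 0"
proof -
  define t where "t = prob_vec \<mu>"
  define p where "p = bind_pmf (map_pmf Some \<mu>) P"
  define l where "l = measure_pmf.prob p {y. y \<noteq> None}"
  have t0: "0 \<le> t $ x" for x by (simp add: t_def prob_vec_def)
  have t1: "(\<Sum>x\<in>UNIV. t $ x) = 1" by (simp add: t_def prob_vec_def sum_pmf_eq_1)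
  have pmf_p: "pmf p (Some x) = (t v* killed_matrix P) $ x" for x
    unfolding p_def
    by (simp add: pmf_bind map_pmf_def bind_assoc_pmf bind_return_pmf integral_measure_pmf[of UNIV]
        vector_matrix_mult_def t_def prob_vec_def killed_matrix_def)
  have cond: "pmf p (Some x) / l = t $ x" for x
  proof -
    have "{y. y = Some x \<and> y \<noteq> None} = {Some x}" by auto
    then show ?thesis
      using qsd[unfolded quasi_stationary_def, rule_format, of 1 x]
      by (simp add: cond_prob_def l_def t_def prob_vec_def measure_pmf_single flip: p_def)
  qed
  \<comment> \<open>If \<open>l\<close> were 0, the quotient in \<open>cond\<close> would be 0 as a
    division by zero, and \<open>t\<close> would have no mass.\<close>
  have "l \<noteq> 0" using cond t1 by auto
  then have l0: "0 < l" using measure_nonneg[of p "{y. y \<noteq> None}"] by (simp add: l_def less_le)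
  have tQ: "t v* killed_matrix P = l *\<^sub>R t"
    using cond l0 by (simp add: vec_eq_iff pmf_p field_simps)
  have irr: "S = UNIV" if "S \<noteq> {}" "\<And>x y. x \<in> S \<Longrightarrow> killed_matrix P $ x $ y > 0 \<Longrightarrow> y \<in> S" for S
    using irreducible_closed_set[OF absorbing irreducible] that by blast
  have Q0: "0 \<le> killed_matrix P $ x $ y" for x y by (simp add: killed_matrix_def)
  \<comment> \<open>The eigenvector equation makes the support of \<open>t\<close> closed under
    positive transitions.\<close>
  have "{x. t $ x > 0} = UNIV"
  proof (rule irr)
    show "{x. t $ x > 0} \<noteq> {}"
    proof
      assume "{x. t $ x > 0} = {}"
      then have "t $ x = 0" for x using t0[of x] by (metis (mono_tags) empty_Collect_eq less_le)
      then show False using t1 by simp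
    qed
    fix x y assume x: "x \<in> {x. t $ x > 0}" and xy: "killed_matrix P $ x $ y > 0"
    have "0 < t $ x * killed_matrix P $ x $ y" using x xy by simp
    also have "\<dots> \<le> (t v* killed_matrix P) $ y"
      unfolding vector_matrix_mult_def using t0 Q0 by (simp, intro member_le_sum) auto
    also have "\<dots> = l * t $ y" by (simp add: tQ)
    finally show "y \<in> {x. t $ x > 0}" using l0 by (simp add: zero_less_mult_iff)
  qed
  then have t_pos: "t $ x > 0" for x by blast
  \<comment> \<open>Total mass after one step. Since \<open>t\<close> charges every state, some mass
    is lost where killing is possible.\<close>
  have "l = (\<Sum>y\<in>UNIV. (t v* killed_matrix P) $ y)" by (simp add: tQ t1 flip: sum_distrib_left)
  also have "\<dots> = (\<Sum>x\<in>UNIV. t $ x * (1 - pmf (P (Some x)) None))"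
    unfolding vector_matrix_mult_def
    by (simp, subst sum.swap) (simp add: killed_matrix_def sum_pmf_Some flip: sum_distrib_left)
  also have "\<dots> < (\<Sum>x\<in>UNIV. t $ x)"
  proof -
    obtain x where x: "pmf (P (Some x)) None > 0" using killing by blast
    show ?thesis
    proof (rule sum_strict_mono_ex1)
      show "\<exists>x\<in>UNIV. t $ x * (1 - pmf (P (Some x)) None) < t $ x"
        using x t_pos[of x] by (intro bexI[of _ x]) (auto simp: algebra_simps)
    qed (auto simp: algebra_simps t0)
  qed
  finally have "l < 1" by (simp add: t1)
  with l0 tQ t_pos show ?thesis unfolding t_def by (intro that)
qed

text \<open>\<open>G\<close> has the same eigenvectors as the killed matrix, with eigenvalue
  \<open>1 / (1 - l)\<close> in place of \<open>l\<close>.\<close>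

lemma perron_data:
  fixes P :: "'d::finite option \<Rightarrow> 'd option pmf"
  assumes absorbing: "pmf (P None) None = 1" and irreducible: "irreducible_class P (range Some)"
    and killing: "\<exists>x. pmf (P (Some x)) None > 0" and qsd: "quasi_stationary P \<mu>"
  obtains G h r \<delta> where "perron_matrix G h (prob_vec \<mu>) r \<delta>" "(mat 1 - killed_matrix P) ** G = mat 1"
proof -
  define t where "t = prob_vec \<mu>"
  define Q where "Q = killed_matrix P"
  obtain l where l: "0 < l" "l < 1" and tQ: "t v* Q = l *\<^sub>R t" and t: "\<And>x. t $ x > 0"
    using quasi_stationary_left_eigenvector[OF assms] unfolding t_def Q_def by blast
  have Q0: "0 \<le> Q $ x $ y" for x y by (simp add: Q_def killed_matrix_def)
  obtain h where h: "h \<noteq> 0" "\<And>x. 0 \<le> h $ x" "Q *v h = l *\<^sub>R h"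
    using right_eigenvector_nonneg[OF Q0 t tQ] l by auto
  obtain G where G: "(mat 1 - Q) ** G = mat 1" "G ** (mat 1 - Q) = mat 1" "\<And>x y. G $ x $ y > 0"
    using green_matrix_pos[OF Q0 t tQ l(2)] irreducible_closed_set[OF absorbing irreducible]
    unfolding Q_def by metis
  define r where "r = 1 / (1 - l)"
  have r: "0 < r" "r * (1 - l) = 1" using l by (auto simp: r_def)
  have tG: "t v* G = r *\<^sub>R t"
  proof -
    have "t v* (mat 1 - Q) = (1 - l) *\<^sub>R t"
      by (simp add: vector_matrix_mult_diff_rdistrib tQ scaleR_diff_left)
    then have "r *\<^sub>R ((t v* (mat 1 - Q)) v* G) = r *\<^sub>R (((1 - l) *\<^sub>R t) v* G)" by simp
    then show ?thesis by (simp add: vector_matrix_mul_assoc G scaleR_vector_matrix_assoc r)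
  qed
  have Gh: "G *v h = r *\<^sub>R h"
  proof -
    have "(mat 1 - Q) *v h = (1 - l) *\<^sub>R h"
      by (simp add: matrix_vector_mult_diff_rdistrib h scaleR_diff_left)
    then have "r *\<^sub>R (G *v ((mat 1 - Q) *v h)) = r *\<^sub>R (G *v ((1 - l) *\<^sub>R h))" by simp
    then show ?thesis by (simp add: matrix_vector_mul_assoc G matrix_vector_mult_scaleR r)
  qed
  \<comment> \<open>The entrywise positive \<open>G\<close> maps the nonzero nonnegative
    \<open>h\<close> to a positive vector, and that vector is \<open>r *\<^sub>R h\<close>.\<close>
  have h_pos: "h $ x > 0" for x
  proof -
    obtain y where y: "h $ y \<noteq> 0" using h(1) by (auto simp: vec_eq_iff)
    have "0 < G $ x $ y * h $ y" using G(3)[of x y] h(2)[of y] y by simp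
    also have "\<dots> \<le> (G *v h) $ x"
      unfolding matrix_vector_mult_def using h(2) less_imp_le[OF G(3)]
      by (simp, intro member_le_sum) auto
    also have "\<dots> = r * h $ x" by (simp add: Gh)
    finally show ?thesis using r by (simp add: zero_less_mult_iff)
  qed
  define c where "c = t \<bullet> h"
  have c: "0 < c" unfolding c_def inner_vec_def by (auto intro!: sum_pos simp: t h_pos)
  define h' where "h' = (1 / c) *\<^sub>R h"
  have h'_pos: "h' $ x > 0" for x using h_pos c by (simp add: h'_def)
  define R where "R = range (\<lambda>(x, y). G $ x $ y / (r * h' $ x * t $ y))"
  have R: "finite R" "R \<noteq> {}" "\<And>z. z \<in> R \<Longrightarrow> 0 < z"
    using r t h'_pos G(3) by (auto simp: R_def)
  \<comment> \<open>The smallest ratio gives the minorization. The cap \<open>1 / 2\<close> keeps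
    \<open>\<delta> < 1\<close>: with a single transient state the ratio is 1.\<close>
  define \<delta> where "\<delta> = min (1 / 2) (Min R)"
  have \<delta>: "0 < \<delta>" "\<delta> < 1" using R by (auto simp: \<delta>_def min_less_iff_disj)
  have "\<delta> * r * h' $ x * t $ y \<le> G $ x $ y" for x y
  proof -
    have "\<delta> \<le> G $ x $ y / (r * h' $ x * t $ y)"
      unfolding \<delta>_def using R(1) by (intro min.coboundedI2 Min_le) (auto simp: R_def)
    moreover have "0 < r * h' $ x * t $ y" using r t h'_pos by simp
    ultimately show ?thesis by (simp add: pos_le_divide_eq mult.assoc)
  qed
  moreover have "t \<bullet> h' = 1" using c by (simp add: h'_def c_def)
  moreover have "G *v h' = r *\<^sub>R h'" by (simp add: h'_def matrix_vector_mult_scaleR Gh)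
  moreover have "(\<Sum>x\<in>UNIV. t $ x) = 1" by (simp add: t_def prob_vec_def sum_pmf_eq_1)
  ultimately have "perron_matrix G h' t r \<delta>"
    using h'_pos t r \<delta> tG by unfold_locales auto
  then show ?thesis using G(1) unfolding t_def Q_def by (rule that)
qed

lemma vector_matrix_mult_bounded:
  fixes A :: "real^'n^'m"
  obtains C where "0 < C" "\<And>v. norm (v v* A) \<le> C * norm v"
proof -
  have "bounded_linear (\<lambda>v. transpose A *v v)" by (rule matrix_vector_mul_bounded_linear)
  from bounded_linear.pos_bounded[OF this] show ?thesis
    using that by (auto simp: mult.commute)
qed

section \<open>Reduction of a trajectory to the perturbed recursion\<close>

context algorithm_run
begin

text \<open>Solving the Poisson equation with \<open>G\<close>, the inverse of \<open>1 - Q\<close>, replaces the empirical measure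
  by its mean-field value \<open>(emp \<bullet> killing_vec) \<theta> G\<close> up to increments.\<close>

lemma \<theta>_recursion:
  fixes G :: "real^'d^'d"
  assumes G: "(mat 1 - killed_matrix P) ** G = mat 1" and \<omega>: "\<omega> \<in> space M"
  defines "T \<equiv> \<lambda>j. cumulative_noise j \<omega> v* G +
    (\<Sum>i<j. step_size g (Suc i) *\<^sub>R (emp (Suc i) \<omega> - emp i \<omega>)) v* (mat 1 - G)"
  shows "\<theta> (Suc j) \<omega> = \<theta> j \<omega> + step_size g (Suc j) *\<^sub>R
    ((emp j \<omega> \<bullet> killing_vec P) *\<^sub>R (\<theta> j \<omega> v* G) - \<theta> j \<omega>) + (T (Suc j) - T j)"
proof -
  define m m' c where "m = emp j \<omega>" and "m' = emp (Suc j) \<omega>" and "c = emp j \<omega> \<bullet> killing_vec P"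
  define D where "D = m' - m"
  \<comment> \<open>The definition of \<open>noise\<close> solved for the current empirical measure,
    with the next one written as \<open>m + D\<close>. Applying \<open>G\<close> inverts the
    left-hand side.\<close>
  have "m v* (mat 1 - killed_matrix P) = c *\<^sub>R \<theta> j \<omega> + noise j \<omega> - D"
    by (simp add: noise_def D_def m_def m'_def c_def vector_matrix_mult_diff_rdistrib)
  then have "(m v* (mat 1 - killed_matrix P)) v* G = (c *\<^sub>R \<theta> j \<omega> + noise j \<omega> - D) v* G"
    by simp
  then have m: "m = c *\<^sub>R (\<theta> j \<omega> v* G) + noise j \<omega> v* G - D v* G"
    by (simp add: vector_matrix_mul_assoc G vector_matrix_mult_diff_distrib vector_matrix_left_distrib
        scaleR_vector_matrix_assoc)
  have D: "emp (Suc j) \<omega> - emp j \<omega> = D" by (simp add: D_def m_def m'_def)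
  have T: "T (Suc j) - T j = step_size g (Suc j) *\<^sub>R (noise j \<omega> v* G + (D - D v* G))"
  proof -
    have "T (Suc j) - T j = (step_size g (Suc j) *\<^sub>R noise j \<omega>) v* G
      + (step_size g (Suc j) *\<^sub>R (emp (Suc j) \<omega> - emp j \<omega>)) v* (mat 1 - G)"
      by (simp add: T_def cumulative_noise_def vector_matrix_left_distrib)
    then show ?thesis
      by (simp only: D scaleR_vector_matrix_assoc vector_matrix_mult_diff_rdistrib
          vector_matrix_mul_rid scaleR_add_right scaleR_diff_right)
  qed
  have "\<theta> (Suc j) \<omega> = \<theta> j \<omega> + step_size g (Suc j) *\<^sub>R (m' - \<theta> j \<omega>)"
    by (simp add: \<theta>_step[OF \<omega>] m'_def algebra_simps)
  also have "m' - \<theta> j \<omega> = (c *\<^sub>R (\<theta> j \<omega> v* G) - \<theta> j \<omega>) + (noise j \<omega> v* G + (D - D v* G))"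
  proof -
    have "m' = m + D" by (simp add: D_def)
    then show ?thesis using m by (simp add: algebra_simps)
  qed
  finally show ?thesis unfolding T by (simp add: c_def scaleR_add_right)
qed

lemma killing_prob_bounds: "0 \<le> emp k \<omega> \<bullet> killing_vec P" "emp k \<omega> \<bullet> killing_vec P \<le> 1"
proof -
  show "0 \<le> emp k \<omega> \<bullet> killing_vec P"
    unfolding inner_vec_def by (auto intro!: sum_nonneg mult_nonneg_nonneg simp: emp_nonneg killing_vec_def)
  have "emp k \<omega> \<bullet> killing_vec P \<le> (\<Sum>x\<in>UNIV. emp k \<omega> $ x)"
    unfolding inner_vec_def by (intro sum_mono) (simp add: emp_nonneg killing_vec_def mult_left_le pmf_le_1)
  then show "emp k \<omega> \<bullet> killing_vec P \<le> 1" by (simp add: emp_sum)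
qed

lemma norm_emp_le: "norm (emp k \<omega>) \<le> 1"
  using norm_le_l1_cart[of "emp k \<omega>"] by (simp add: emp_nonneg emp_sum)

end

text \<open>A pathwise statement: if the noise after \<open>J\<close> stays below
  \<open>J powr (-1/4)\<close> up to time \<open>k\<close>, then
  \<open>perturbed_recursion_bound\<close> applies with \<open>\<tau>\<close> a multiple of that
  size. The constants precede the run and the sample point.\<close>

lemma rate_on_good_event:
  fixes P :: "'d::finite option \<Rightarrow> 'd option pmf" and M :: "'w measure"
  assumes absorbing: "pmf (P None) None = 1" and irreducible: "irreducible_class P (range Some)"
    and killing: "\<exists>x. pmf (P (Some x)) None > 0" and qsd: "quasi_stationary P \<mu>" and g: "0 < g"
  obtains C b n0 :: real and J0 :: nat where "0 \<le> C" "0 < b" "0 < n0"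
    "\<And>N X \<theta> F \<omega> J k. algorithm_run M P g x\<^sub>0 N X \<theta> F \<Longrightarrow> \<omega> \<in> space M \<Longrightarrow> J0 \<le> J \<Longrightarrow> J \<le> k \<Longrightarrow>
      (\<And>j x. J \<le> j \<Longrightarrow> j \<le> k \<Longrightarrow>
        \<bar>(algorithm_run.cumulative_noise P g N X \<theta> j \<omega> - algorithm_run.cumulative_noise P g N X \<theta> J \<omega>) $ x\<bar>
          \<le> real J powr (-1/4)) \<Longrightarrow>
      norm (\<theta> k \<omega> - prob_vec \<mu>) \<le> C * (((real J + n0) / (real k + n0)) powr b + real J powr (-1/4))"
proof -
  obtain G h r \<delta> where perron: "perron_matrix G h (prob_vec \<mu>) r \<delta>"
    and G: "(mat 1 - killed_matrix P) ** G = mat 1"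
    using perron_data[OF absorbing irreducible killing qsd] by blast
  interpret perron_matrix G h "prob_vec \<mu>" r \<delta> by (rule perron)
  define n0 where "n0 = real_of_int \<lfloor>g\<rfloor> + 1"
  have n0: "1 \<le> n0" using g by (simp add: n0_def)
  have n0': "0 < n0" using n0 by simp
  show ?thesis
  proof (rule perturbed_recursion_bound[OF g n0'], goal_cases)
    case (1 C \<tau>0 b J0)
    note C = 1(1) and \<tau>0 = 1(2) and b = 1(3) and bound = 1(4)
    obtain B1 where B1: "0 < B1" "\<And>v. norm (v v* G) \<le> B1 * norm v"
      using vector_matrix_mult_bounded[of G] by blast
    obtain B2 where B2: "0 < B2" "\<And>v. norm (v v* (mat 1 - G)) \<le> B2 * norm v"
      using vector_matrix_mult_bounded[of "mat 1 - G"] by blast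
    \<comment> \<open>The first summand controls the noise transported by \<open>G\<close>, the
      second the step-weighted increments of the empirical measure transported by
      \<open>mat 1 - G\<close>.\<close>
    define B where "B = B1 * real CARD('d) + B2 * (2 * g)"
    have B: "0 < B" using B1 B2 g by (simp add: B_def add_pos_pos)
    have "((\<lambda>J. B * real J powr (-1/4)) \<longlongrightarrow> 0) sequentially" by real_asymp
    then have "eventually (\<lambda>J. B * real J powr (-1/4) < \<tau>0) sequentially"
      using \<tau>0 by (rule order_tendstoD)
    then obtain J1 where J1: "\<And>J. J1 \<le> J \<Longrightarrow> B * real J powr (-1/4) < \<tau>0"
      by (auto simp: eventually_sequentially)
    have "norm (\<theta> k \<omega> - prob_vec \<mu>) \<le> (C * max 1 B) * (((real J + n0) / (real k + n0)) powr b + real J powr (-1/4))"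
      if run: "algorithm_run M P g x\<^sub>0 N X \<theta> F" and \<omega>: "\<omega> \<in> space M"
        and J: "max 1 (max J0 J1) \<le> J" "J \<le> k"
        and good: "\<And>j x. J \<le> j \<Longrightarrow> j \<le> k \<Longrightarrow>
          \<bar>(algorithm_run.cumulative_noise P g N X \<theta> j \<omega> - algorithm_run.cumulative_noise P g N X \<theta> J \<omega>) $ x\<bar>
            \<le> real J powr (-1/4)"
      for N X \<theta> F \<omega> J k
    proof -
      interpret algorithm_run M P g x\<^sub>0 N X \<theta> F by (rule run)
      define T where "T j = cumulative_noise j \<omega> v* G +
        (\<Sum>i<j. step_size g (Suc i) *\<^sub>R (emp (Suc i) \<omega> - emp i \<omega>)) v* (mat 1 - G)" for j
      define q where "q = real J powr (-1/4)"
      have "norm (\<theta> k \<omega> - prob_vec \<mu>) \<le> C * (((real J + n0) / (real k + n0)) powr b + B * q)"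
      proof (rule bound[where \<theta> = "\<lambda>j. \<theta> j \<omega>" and T = T and c = "\<lambda>j. emp j \<omega> \<bullet> killing_vec P"])
        show "\<theta> (Suc j) \<omega> = \<theta> j \<omega> + (g / (real j + n0)) *\<^sub>R
          ((emp j \<omega> \<bullet> killing_vec P) *\<^sub>R (\<theta> j \<omega> v* G) - \<theta> j \<omega>) + (T (Suc j) - T j)" for j
          using \<theta>_recursion[OF G \<omega>, of j] by (simp only: T_def step_size_Suc n0_def)
        show "norm (T j - T J) \<le> B * q" if j: "J \<le> j" "j \<le> k" for j
        proof -
          have "norm (cumulative_noise j \<omega> - cumulative_noise J \<omega>)
            \<le> (\<Sum>x\<in>UNIV. \<bar>(cumulative_noise j \<omega> - cumulative_noise J \<omega>) $ x\<bar>)"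
            by (rule norm_le_l1_cart)
          also have "\<dots> \<le> (\<Sum>x\<in>(UNIV::'d set). q)" using good[OF j] unfolding q_def by (intro sum_mono)
          finally have S: "norm (cumulative_noise j \<omega> - cumulative_noise J \<omega>) \<le> real CARD('d) * q" by simp
          \<comment> \<open>Individual increments of the empirical measure are not small, but Abel
            summation bounds their weighted sum by twice the first step size, which is at most
            \<open>g / J\<close> and thus below \<open>g * J powr (-1/4)\<close>.\<close>
          define E where "E = (\<Sum>i=J..<j. step_size g (Suc i) *\<^sub>R (emp (Suc i) \<omega> - emp i \<omega>))"
          have "norm E \<le> 2 * step_size g (Suc J)"
            unfolding E_def
          proof (rule summation_by_parts_bound[OF norm_emp_le _ _ j(1)])
            show "step_size g (Suc (Suc i)) \<le> step_size g (Suc i)" for i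
              unfolding step_size_Suc using g zero_le_floor[of g] by (intro frac_le) (simp_all del: zero_le_floor)
          qed (rule step_size_bounds[OF g])
          also have "step_size g (Suc J) \<le> g * q"
          proof -
            have "step_size g (Suc J) \<le> g / real J"
              unfolding step_size_Suc using g J by (intro frac_le) auto
            also have "\<dots> = g * real J powr (-1)" using J by (simp add: powr_minus divide_inverse)
            also have "\<dots> \<le> g * q" unfolding q_def using g J by (intro mult_left_mono powr_mono) auto
            finally show ?thesis .
          qed
          finally have E: "norm E \<le> 2 * g * q" by simp
          have "(\<Sum>i<j. step_size g (Suc i) *\<^sub>R (emp (Suc i) \<omega> - emp i \<omega>))
            = (\<Sum>i<J. step_size g (Suc i) *\<^sub>R (emp (Suc i) \<omega> - emp i \<omega>)) + E"
            unfolding E_def using j(1) by (simp add: sum.atLeastLessThan_concat lessThan_atLeast0)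
          then have "T j - T J = (cumulative_noise j \<omega> - cumulative_noise J \<omega>) v* G + E v* (mat 1 - G)"
            by (simp add: T_def vector_matrix_left_distrib vector_matrix_mult_diff_distrib)
          then have "norm (T j - T J) \<le> norm ((cumulative_noise j \<omega> - cumulative_noise J \<omega>) v* G)
              + norm (E v* (mat 1 - G))"
            by (simp only: norm_triangle_ineq)
          also have "\<dots> \<le> B1 * norm (cumulative_noise j \<omega> - cumulative_noise J \<omega>) + B2 * norm E"
            by (intro add_mono B1 B2)
          also have "\<dots> \<le> B1 * (real CARD('d) * q) + B2 * (2 * g * q)"
            using S E B1(1) B2(1) by (intro add_mono mult_left_mono) auto
          also have "\<dots> = B * q" by (simp add: B_def algebra_simps)
          finally show ?thesis .
        qed
        show "B * q \<le> \<tau>0" using J1[of J] J unfolding q_def by simp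
      qed (use J B \<theta>_nonneg[OF \<omega>] \<theta>_sum[OF \<omega>] killing_prob_bounds in \<open>auto simp: q_def\<close>)
      also have "\<dots> \<le> C * (max 1 B * ((real J + n0) / (real k + n0)) powr b + max 1 B * q)"
        using mult_right_mono[of 1 "max 1 B" "((real J + n0) / (real k + n0)) powr b"]
          mult_right_mono[of B "max 1 B" q]
        by (intro mult_left_mono C add_mono) (auto simp: q_def)
      finally show ?thesis by (simp add: q_def algebra_simps)
    qed
    then show ?thesis using C b n0 by (intro that[of "C * max 1 B" b n0 "max 1 (max J0 J1)"]) auto
  qed
qed

section \<open>Change of norm, choice of time scales and Borel-Cantelli\<close>

lemma summable_sq_exp_neg_powr:
  assumes "0 < q"
  shows "summable (\<lambda>n. (real n + 1)\<^sup>2 * exp (- (real n powr q)))"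
proof (rule summable_comparison_test_bigo)
  show "summable (\<lambda>n. norm (1 / (real n)\<^sup>2))"
    using inverse_power_summable[of 2, where 'a = real] by (simp add: divide_inverse)
  show "(\<lambda>n. (real n + 1)\<^sup>2 * exp (- (real n powr q))) \<in> O(\<lambda>n. 1 / (real n)\<^sup>2)"
    using assms by real_asymp
qed

lemma nrm_le_norm:
  fixes nrm :: "real^'d \<Rightarrow> real"
  assumes "is_norm nrm"
  obtains c where "0 < c" "\<And>v. nrm v \<le> c * norm v"
proof -
  have nonneg: "\<And>v. nrm v \<ge> 0" and zero: "\<And>v. nrm v = 0 \<longleftrightarrow> v = 0"
    and scale: "\<And>c v. nrm (c *\<^sub>R v) = \<bar>c\<bar> * nrm v" and add: "\<And>v w. nrm (v + w) \<le> nrm v + nrm w"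
    using assms by (auto simp: is_norm_def)
  have sum: "nrm (\<Sum>x\<in>A. f x) \<le> (\<Sum>x\<in>A. nrm (f x))" if "finite A" for A and f :: "'d \<Rightarrow> real^'d"
    using that
  proof (induction A rule: finite_induct)
    case (insert x A)
    then show ?case using add[of "f x" "sum f A"] by simp
  qed (use zero[of 0] in simp)
  define c where "c = (\<Sum>x\<in>(UNIV::'d set). nrm (axis x 1))"
  have "nrm v \<le> (c + 1) * norm v" for v
  proof -
    have "nrm v = nrm (\<Sum>x\<in>UNIV. v $ x *\<^sub>R axis x 1)"
      using basis_expansion[of v] by (simp add: scalar_mult_eq_scaleR)
    also have "\<dots> \<le> (\<Sum>x\<in>UNIV. \<bar>v $ x\<bar> * nrm (axis x 1))"
      by (rule order_trans[OF sum]) (simp_all add: scale)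
    also have "\<dots> \<le> (\<Sum>x\<in>UNIV. norm v * nrm (axis x 1))"
      by (intro sum_mono mult_right_mono component_le_norm_cart nonneg)
    also have "\<dots> = c * norm v" by (simp add: c_def sum_distrib_left mult.commute)
    also have "\<dots> \<le> (c + 1) * norm v" by (intro mult_right_mono) auto
    finally show ?thesis .
  qed
  moreover have "0 \<le> c" unfolding c_def by (intro sum_nonneg nonneg)
  ultimately show ?thesis by (intro that[of "c + 1"]) auto
qed

text \<open>Starting at \<open>J\<close> near the square root of \<open>k\<close> balances the
  errors: the initial condition is forgotten at rate \<open>k powr (- b / 2)\<close>, and the noise
  scale \<open>J powr (-1/4)\<close> is at most \<open>k powr (-1/8)\<close>.\<close>

lemma sqrt_scale_bound:
  fixes b n0 :: real
  assumes b: "0 < b" and n0: "0 < n0" and k: "1 \<le> k" and J: "J = nat \<lceil>sqrt (real k)\<rceil>"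
  shows "J \<le> k" "sqrt (real k) \<le> real J"
    "((real J + n0) / (real k + n0)) powr b + real J powr (-1/4)
      \<le> ((2 + n0) powr b + 1) * real k powr (- min (b / 2) (1 / 8))"
proof -
  define y where "y = sqrt (real k)"
  have y: "1 \<le> y" "y * y = real k" using k by (auto simp: y_def)
  have yk: "y \<le> real k" using mult_left_mono[OF y(1), of y] y by simp
  show "J \<le> k" using yk unfolding J y_def by (simp add: nat_le_iff ceiling_le_iff)
  show yJ: "sqrt (real k) \<le> real J" unfolding J by (rule real_nat_ceiling_ge)
  have J1: "real J \<le> y + 1" using y by (simp add: J flip: y_def)
  have y_powr: "y powr c = real k powr (c / 2)" for c
    using k by (simp add: y_def powr_half_sqrt[symmetric] powr_powr)
  have "(real J + n0) / (real k + n0) \<le> ((2 + n0) * y) / real k"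
  proof (rule frac_le)
    have "1 + n0 \<le> (1 + n0) * y" using mult_left_mono[OF y(1), of "1 + n0"] n0 by simp
    then show "real J + n0 \<le> (2 + n0) * y" using J1 by (simp add: algebra_simps)
  qed (use n0 k y in auto)
  also have "\<dots> = (2 + n0) * y powr (-1)" using y by (simp add: powr_minus field_simps flip: y(2))
  finally have "((real J + n0) / (real k + n0)) powr b \<le> ((2 + n0) * y powr (-1)) powr b"
    using n0 b by (intro powr_mono2) auto
  also have "\<dots> = (2 + n0) powr b * y powr (- b)" using n0 y by (simp only: powr_mult powr_powr mult_minus1)
  also have "\<dots> \<le> (2 + n0) powr b * real k powr (- min (b / 2) (1 / 8))"
    unfolding y_powr using k by (intro mult_left_mono powr_mono) auto
  finally have 1: "((real J + n0) / (real k + n0)) powr b \<le> (2 + n0) powr b * real k powr (- min (b / 2) (1 / 8))" .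
  have "real J powr (-1/4) \<le> y powr (-1/4)" using y yJ by (intro powr_mono2') (auto simp: y_def)
  also have "\<dots> \<le> real k powr (- min (b / 2) (1 / 8))"
    unfolding y_powr using k by (intro powr_mono) auto
  finally show "((real J + n0) / (real k + n0)) powr b + real J powr (-1/4)
      \<le> ((2 + n0) powr b + 1) * real k powr (- min (b / 2) (1 / 8))"
    using 1 by (simp add: distrib_right)
qed

text \<open>The initial time \<open>J\<close> of the comparison is taken to be about \<open>\<surd>k\<close>, so that both the forgetting of
  the initial condition and the noise after \<open>J\<close> are polynomially small in \<open>k\<close>.\<close>

lemma AE_eventually_rate:
  fixes P :: "'d::finite option \<Rightarrow> 'd option pmf" and M :: "'w measure"
  assumes absorbing: "pmf (P None) None = 1" and irreducible: "irreducible_class P (range Some)"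
    and killing: "\<exists>x. pmf (P (Some x)) None > 0" and qsd: "quasi_stationary P \<mu>" and g: "0 < g"
    and run: "\<And>n. 1 \<le> n \<Longrightarrow> algorithm_run M P g x\<^sub>0 (a n) (X n) (\<theta> n) (F n)"
  obtains \<beta> C where "0 < \<beta>"
    "\<And>p. 0 < p \<Longrightarrow> AE \<omega> in M. eventually (\<lambda>n. \<forall>k::nat. real n powr p \<le> real k \<and> k \<le> n \<longrightarrow>
      norm (\<theta> n k \<omega> - prob_vec \<mu>) \<le> C * real k powr (- \<beta>)) sequentially"
proof -
  show ?thesis
  proof (rule rate_on_good_event[OF absorbing irreducible killing qsd g, where x\<^sub>0 = x\<^sub>0 and M = M], goal_cases)
    case (1 C b n0 J0)
    note C = 1(1) and b = 1(2) and n0 = 1(3) and bound = 1(4)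
    \<comment> \<open>The exponent from \<open>sqrt_scale_bound\<close>, fixed before
      \<open>p\<close>, which enters only through the start times in \<open>I\<close> below.\<close>
    define \<beta> where "\<beta> = min (b / 2) (1 / 8)"
    have \<beta>: "0 < \<beta>" using b by (simp add: \<beta>_def)
    interpret prob_space M using run[of 1] by (simp add: algorithm_run_def)
    define S where "S n = algorithm_run.cumulative_noise P g (a n) (X n) (\<theta> n)" for n
    define bad where "bad n J j x = {\<omega>\<in>space M. real J powr (-1/4) \<le> \<bar>(S n j \<omega> - S n J \<omega>) $ x\<bar>}" for n J j x
    have "AE \<omega> in M. eventually (\<lambda>n. \<forall>k::nat. real n powr p \<le> real k \<and> k \<le> n \<longrightarrow>
        norm (\<theta> n k \<omega> - prob_vec \<mu>) \<le> C * ((2 + n0) powr b + 1) * real k powr (- \<beta>)) sequentially"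
      if p: "0 < p" for p
    proof -
      \<comment> \<open>The possible start times: \<open>n powr p \<le> k \<le> n\<close> puts
        \<open>J\<close>, the rounded square root of \<open>k\<close>, between
        \<open>n powr (p / 2)\<close> and \<open>n\<close>.\<close>
      define I where "I n = {J. J \<le> n \<and> real n powr (p / 2) \<le> real J}" for n
      \<comment> \<open>Letting \<open>j\<close> run up to \<open>n\<close> covers every terminal
        time \<open>k\<close> at once. The value at 0 is a dummy, since runs exist only for
        \<open>n \<ge> 1\<close>.\<close>
      define Bad where "Bad n = (if n = 0 then {} else (\<Union>J\<in>I n. \<Union>j\<in>{J..n}. \<Union>x\<in>UNIV. bad n J j x))" for n
      have I: "finite (I n)" "card (I n) \<le> n + 1" for n
      proof -
        have "I n \<subseteq> {..n}" by (auto simp: I_def)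
        then show "finite (I n)" "card (I n) \<le> n + 1"
          using finite_subset card_mono[of "{..n}" "I n"] by auto
      qed
      have bad_sets: "bad n J j x \<in> sets M" if "1 \<le> n" for n J j x
      proof -
        have [measurable]: "(\<lambda>\<omega>. S n i \<omega> $ x) \<in> borel_measurable M" for i
          unfolding S_def by (rule algorithm_run.cumulative_noise_measurable[OF run[OF that]])
        show ?thesis unfolding bad_def vector_minus_component by measurable
      qed
      have Bad_sets: "Bad n \<in> sets M" for n
        using I bad_sets by (auto simp: Bad_def intro!: sets.finite_UN)
      have "eventually (\<lambda>n. 1 \<le> n \<and> max 1 (max (g\<^sup>2) (real J0)) \<le> real n powr (p / 2)) sequentially"
      proof (rule eventually_conj)
        have "filterlim (\<lambda>n. real n powr (p / 2)) at_top sequentially" using p by real_asymp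
        then show "eventually (\<lambda>n. max 1 (max (g\<^sup>2) (real J0)) \<le> real n powr (p / 2)) sequentially"
          by (simp only: filterlim_at_top)
      qed (rule eventually_ge_at_top)
      then obtain n1 where n1: "\<And>n. n1 \<le> n \<Longrightarrow> 1 \<le> n"
        "\<And>n. n1 \<le> n \<Longrightarrow> max 1 (max (g\<^sup>2) (real J0)) \<le> real n powr (p / 2)"
        by (auto simp: eventually_sequentially)
      have prob_Bad: "prob (Bad n) \<le> (2 * real CARD('d) * exp (g\<^sup>2)) * ((real n + 1)\<^sup>2 * exp (- (real n powr (p / 8))))"
        if n: "n1 \<le> n" for n
      proof -
        \<comment> \<open>Every start time has \<open>J powr (1/4) \<ge> n powr (p / 8)\<close>, so
          \<open>e\<close> bounds each event; the union has at most
          \<open>(n + 1)\<^sup>2 * CARD('d)\<close> of them.\<close>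
        define e where "e = 2 * exp (g\<^sup>2 - real n powr (p / 8))"
        have e0: "0 \<le> e" by (simp add: e_def)
        have n': "1 \<le> n" using n1 n by blast
        have e: "prob (bad n J j x) \<le> e" if J: "J \<in> I n" "j \<in> {J..n}" for J j x
        proof -
          have J': "real n powr (p / 2) \<le> real J" using J by (simp add: I_def)
          then have "max 1 (max (g\<^sup>2) (real J0)) \<le> real J" using n1(2)[OF n] by linarith
          then have "prob (bad n J j x) \<le> 2 * exp (g\<^sup>2 - real J powr (1/4))"
            unfolding bad_def S_def using J
            by (intro algorithm_run.prob_cumulative_noise_ge[OF run[OF n']]) auto
          also have "(real n powr (p / 2)) powr (1/4) \<le> real J powr (1/4)"
            using J' by (intro powr_mono2) auto
          then have "2 * exp (g\<^sup>2 - real J powr (1/4)) \<le> e" by (simp add: e_def powr_powr)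
          finally show ?thesis .
        qed
        have "prob (Bad n) \<le> (\<Sum>J\<in>I n. prob (\<Union>j\<in>{J..n}. \<Union>x\<in>UNIV. bad n J j x))"
          unfolding Bad_def using n' I bad_sets[OF n']
          by (simp, intro finite_measure_subadditive_finite) (auto intro!: sets.finite_UN)
        also have "\<dots> \<le> (\<Sum>J\<in>I n. real (n + 1) * (real CARD('d) * e))"
        proof (rule sum_mono)
          fix J assume J: "J \<in> I n"
          have "prob (\<Union>j\<in>{J..n}. \<Union>x\<in>UNIV. bad n J j x) \<le> (\<Sum>j\<in>{J..n}. prob (\<Union>x\<in>UNIV. bad n J j x))"
            using bad_sets[OF n'] by (intro finite_measure_subadditive_finite) (auto intro!: sets.finite_UN)
          also have "\<dots> \<le> (\<Sum>j\<in>{J..n}. real CARD('d) * e)"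
          proof (rule sum_mono)
            fix j assume j: "j \<in> {J..n}"
            have "prob (\<Union>x\<in>UNIV. bad n J j x) \<le> (\<Sum>x\<in>UNIV. prob (bad n J j x))"
              using bad_sets[OF n'] by (intro finite_measure_subadditive_finite) auto
            also have "\<dots> \<le> (\<Sum>x\<in>(UNIV::'d set). e)" by (intro sum_mono e J j)
            finally show "prob (\<Union>x\<in>UNIV. bad n J j x) \<le> real CARD('d) * e" by simp
          qed
          also have "\<dots> \<le> real (n + 1) * (real CARD('d) * e)"
            using e0 by (simp only: sum_constant, intro mult_right_mono) auto
          finally show "prob (\<Union>j\<in>{J..n}. \<Union>x\<in>UNIV. bad n J j x) \<le> real (n + 1) * (real CARD('d) * e)" .
        qed
        also have "\<dots> \<le> real (n + 1) * (real (n + 1) * (real CARD('d) * e))"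
          using I(2)[of n] e0 by (simp only: sum_constant, intro mult_right_mono) (auto simp del: of_nat_add)
        also have "\<dots> = (2 * real CARD('d) * exp (g\<^sup>2)) * ((real n + 1)\<^sup>2 * exp (- (real n powr (p / 8))))"
          by (simp add: e_def exp_diff exp_minus power2_eq_square field_simps)
        finally show ?thesis .
      qed
      have "summable (\<lambda>n. prob (Bad n))"
      proof (rule summable_comparison_test_ev)
        show "eventually (\<lambda>n. norm (prob (Bad n)) \<le> (2 * real CARD('d) * exp (g\<^sup>2)) *
            ((real n + 1)\<^sup>2 * exp (- (real n powr (p / 8))))) sequentially"
          using prob_Bad by (auto simp: eventually_sequentially)
        show "summable (\<lambda>n. (2 * real CARD('d) * exp (g\<^sup>2)) * ((real n + 1)\<^sup>2 * exp (- (real n powr (p / 8)))))"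
          using p by (intro summable_mult summable_sq_exp_neg_powr) auto
      qed
      \<comment> \<open>The first Borel-Cantelli lemma uses summability alone, so the joint law of
        runs with different \<open>n\<close> may be arbitrary.\<close>
      then have "AE \<omega> in M. eventually (\<lambda>n. \<omega> \<in> space M - Bad n) sequentially"
        by (intro borel_cantelli_AE1 Bad_sets) (auto simp: emeasure_eq_measure)
      then show ?thesis
      proof (rule AE_mp, intro AE_I2 impI)
        fix \<omega> assume \<omega>: "\<omega> \<in> space M" and ev: "eventually (\<lambda>n. \<omega> \<in> space M - Bad n) sequentially"
        show "eventually (\<lambda>n. \<forall>k::nat. real n powr p \<le> real k \<and> k \<le> n \<longrightarrow>
          norm (\<theta> n k \<omega> - prob_vec \<mu>) \<le> C * ((2 + n0) powr b + 1) * real k powr (- \<beta>)) sequentially"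
          using ev eventually_ge_at_top[of n1]
        proof eventually_elim
          case (elim n)
          show ?case
          proof (intro allI impI, elim conjE)
            fix k :: nat assume k: "real n powr p \<le> real k" "k \<le> n"
            define J where "J = nat \<lceil>sqrt (real k)\<rceil>"
            have n': "1 \<le> n" and n1': "max 1 (max (g\<^sup>2) (real J0)) \<le> real n powr (p / 2)"
              using n1 elim by auto
            have sq: "real n powr (p / 2) = sqrt (real n powr p)"
              by (simp add: powr_half_sqrt[symmetric] powr_powr)
            also have "\<dots> \<le> sqrt (real k)" using k by simp
            finally have k1: "real n powr (p / 2) \<le> sqrt (real k)" .
            with n1' have k0: "1 \<le> k" by (cases k) auto
            note J = sqrt_scale_bound[OF b n0 k0 J_def]
            have JI: "J \<in> I n" using k1 J k by (simp add: I_def)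
            have J0: "J0 \<le> J" using n1' k1 J(2) by (simp add: max_def split: if_splits)
            have "norm (\<theta> n k \<omega> - prob_vec \<mu>) \<le> C * (((real J + n0) / (real k + n0)) powr b + real J powr (-1/4))"
            proof (rule bound[OF run[OF n'] \<omega> J0 J(1)])
              fix j x assume "J \<le> j" "j \<le> k"
              then have "\<omega> \<notin> bad n J j x" using elim JI k n' by (auto simp: Bad_def)
              then show "\<bar>(algorithm_run.cumulative_noise P g (a n) (X n) (\<theta> n) j \<omega> -
                  algorithm_run.cumulative_noise P g (a n) (X n) (\<theta> n) J \<omega>) $ x\<bar> \<le> real J powr (-1/4)"
                using \<omega> by (simp add: bad_def S_def)
            qed
            also have "\<dots> \<le> C * (((2 + n0) powr b + 1) * real k powr (- \<beta>))"
              unfolding \<beta>_def by (intro mult_left_mono J(3) C)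
            finally show "norm (\<theta> n k \<omega> - prob_vec \<mu>) \<le> C * ((2 + n0) powr b + 1) * real k powr (- \<beta>)"
              by (simp add: mult.assoc)
          qed
        qed
      qed
    qed
    then show ?thesis using \<beta> by (intro that)
  qed
qed

theorem theorem1p1:
  fixes P :: "'d::finite option \<Rightarrow> 'd option pmf"
    and \<theta>star :: "'d pmf"
    and nrm :: "real ^ 'd \<Rightarrow> real"
    and g :: real
    and a :: "nat \<Rightarrow> nat"
    and x\<^sub>0 :: 'd
    and M :: "'w measure"
    and X :: "nat \<Rightarrow> nat \<Rightarrow> nat \<Rightarrow> 'w \<Rightarrow> 'd"
    and \<theta> :: "nat \<Rightarrow> nat \<Rightarrow> 'w \<Rightarrow> real ^ 'd"
    and F :: "nat \<Rightarrow> nat \<Rightarrow> 'w measure"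
  assumes absorbing: "pmf (P None) None = 1"
    and irreducible: "irreducible_class P (range Some)"
    and killing: "\<exists>x. pmf (P (Some x)) None > 0"
    and qsd: "quasi_stationary P \<theta>star"
    and nrm: "is_norm nrm"
    and gain: "g > 0"
    and a_pos: "\<And>n. n \<ge> 1 \<Longrightarrow> a n \<ge> 1"
    and a_mono: "mono_on {1..} a"
    and a_lim: "filterlim a at_top sequentially"
    and prob: "prob_space M"
    and alg: "\<And>n. n \<ge> 1 \<Longrightarrow> algorithm_I M P g x\<^sub>0 (a n) (X n) (\<theta> n) (F n)"
  shows "(AE \<omega> in M. (\<lambda>n. \<theta> n n \<omega>) \<longlonglongrightarrow> prob_vec \<theta>star) \<and>
    (\<forall>p\<in>{0<..<1::real}. \<exists>\<beta>>0. AE \<omega> in M. \<exists>n\<^sub>0\<ge>1. \<forall>n\<ge>n\<^sub>0. \<forall>k::nat.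
       real n powr p \<le> real k \<and> k \<le> n \<longrightarrow>
         nrm (\<theta> n k \<omega> - prob_vec \<theta>star) \<le> real k powr (- \<beta>))"
proof -
  have run: "algorithm_run M P g x\<^sub>0 (a n) (X n) (\<theta> n) (F n)" if "1 \<le> n" for n
    using that gain a_pos prob alg by (simp add: algorithm_run_def algorithm_run_axioms_def)
  show ?thesis
  proof (rule AE_eventually_rate[where a = a and X = X and \<theta> = \<theta> and F = F, OF absorbing irreducible killing qsd gain run],
      assumption, goal_cases)
    case (1 \<beta> C)
    note \<beta> = 1(1) and rate = 1(2)
    obtain c where c: "0 < c" "\<And>v. nrm v \<le> c * norm v" using nrm_le_norm[OF nrm] by blast
    \<comment> \<open>With \<open>p = 1\<close> the only admissible \<open>k\<close> is
      \<open>n\<close> itself, so the rate gives convergence along the diagonal.\<close>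
    have "AE \<omega> in M. (\<lambda>n. \<theta> n n \<omega>) \<longlonglongrightarrow> prob_vec \<theta>star"
      using rate[OF zero_less_one]
    proof (rule AE_mp, intro AE_I2 impI)
      fix \<omega> assume "eventually (\<lambda>n. \<forall>k. real n powr 1 \<le> real k \<and> k \<le> n \<longrightarrow>
        norm (\<theta> n k \<omega> - prob_vec \<theta>star) \<le> C * real k powr (- \<beta>)) sequentially"
      then have "eventually (\<lambda>n. norm (\<theta> n n \<omega> - prob_vec \<theta>star) \<le> C * real n powr (- \<beta>)) sequentially"
        by eventually_elim simp
      moreover have "(\<lambda>n. C * real n powr (- \<beta>)) \<longlonglongrightarrow> 0" using \<beta> by real_asymp
      ultimately have "(\<lambda>n. \<theta> n n \<omega> - prob_vec \<theta>star) \<longlonglongrightarrow> 0" by (rule Lim_null_comparison)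
      then show "(\<lambda>n. \<theta> n n \<omega>) \<longlonglongrightarrow> prob_vec \<theta>star" by (simp add: Lim_null[symmetric])
    qed
    moreover have "\<exists>\<beta>>0. AE \<omega> in M. \<exists>n\<^sub>0\<ge>1. \<forall>n\<ge>n\<^sub>0. \<forall>k::nat.
         real n powr p \<le> real k \<and> k \<le> n \<longrightarrow> nrm (\<theta> n k \<omega> - prob_vec \<theta>star) \<le> real k powr (- \<beta>)"
      if p: "p \<in> {0<..<1}" for p :: real
    \<comment> \<open>Half of the exponent is given up to absorb the constant: for large
      \<open>n\<close> one has \<open>c * C \<le> (n powr p) powr (\<beta> / 2) \<le> k powr
      (\<beta> / 2)\<close>.\<close>
    proof (intro exI[of _ "\<beta> / 2"] conjI)
      have p0: "0 < p" using p by simp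
      have "eventually (\<lambda>n. max 1 (c * C) \<le> (real n powr p) powr (\<beta> / 2)) sequentially"
      proof -
        have "filterlim (\<lambda>n. (real n powr p) powr (\<beta> / 2)) at_top sequentially"
          unfolding powr_powr using p0 \<beta> by real_asymp
        then show ?thesis by (simp only: filterlim_at_top)
      qed
      then obtain n1 where n1: "\<And>n. n1 \<le> n \<Longrightarrow> max 1 (c * C) \<le> (real n powr p) powr (\<beta> / 2)"
        by (auto simp: eventually_sequentially)
      show "AE \<omega> in M. \<exists>n\<^sub>0\<ge>1. \<forall>n\<ge>n\<^sub>0. \<forall>k::nat.
         real n powr p \<le> real k \<and> k \<le> n \<longrightarrow> nrm (\<theta> n k \<omega> - prob_vec \<theta>star) \<le> real k powr (- (\<beta> / 2))"
        using rate[OF p0]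
      proof (rule AE_mp, intro AE_I2 impI)
        fix \<omega> assume "eventually (\<lambda>n. \<forall>k::nat. real n powr p \<le> real k \<and> k \<le> n \<longrightarrow>
          norm (\<theta> n k \<omega> - prob_vec \<theta>star) \<le> C * real k powr (- \<beta>)) sequentially"
        then obtain n2 where n2: "\<And>n k. n2 \<le> n \<Longrightarrow> real n powr p \<le> real k \<Longrightarrow> k \<le> n \<Longrightarrow>
          norm (\<theta> n k \<omega> - prob_vec \<theta>star) \<le> C * real k powr (- \<beta>)"
          by (auto simp: eventually_sequentially)
        show "\<exists>n\<^sub>0\<ge>1. \<forall>n\<ge>n\<^sub>0. \<forall>k::nat. real n powr p \<le> real k \<and> k \<le> n \<longrightarrow>
          nrm (\<theta> n k \<omega> - prob_vec \<theta>star) \<le> real k powr (- (\<beta> / 2))"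
        proof (intro exI[of _ "max 1 (max n1 n2)"] conjI allI impI; (elim conjE)?)
          fix n k :: nat assume n: "max 1 (max n1 n2) \<le> n" and k: "real n powr p \<le> real k" "k \<le> n"
          have "max 1 (c * C) \<le> (real n powr p) powr (\<beta> / 2)" using n1 n by simp
          also have "\<dots> \<le> real k powr (\<beta> / 2)" using k \<beta> by (intro powr_mono2) auto
          finally have cC: "c * C \<le> real k powr (\<beta> / 2)" by simp
          have "nrm (\<theta> n k \<omega> - prob_vec \<theta>star) \<le> c * norm (\<theta> n k \<omega> - prob_vec \<theta>star)" by (rule c)
          also have "\<dots> \<le> c * (C * real k powr (- \<beta>))"
            using c(1) n2[OF _ k] n by (intro mult_left_mono) auto
          also have "\<dots> \<le> real k powr (\<beta> / 2) * real k powr (- \<beta>)"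
            using mult_right_mono[OF cC, of "real k powr (- \<beta>)"] by (simp add: mult.assoc)
          also have "\<dots> = real k powr (- (\<beta> / 2))" by (simp flip: powr_add)
          finally show "nrm (\<theta> n k \<omega> - prob_vec \<theta>star) \<le> real k powr (- (\<beta> / 2))" .
        qed simp
      qed
    qed (use \<beta> in simp)
    ultimately show ?thesis by blast
  qed
qed

end
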